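(* Let $G$ be a $\sigma$-compact locally compact abelian group, $(X,G,m)$ a measurable dynamical system, $\mathcal{A}=(A_n)$ a Følner sequence in $G$ and $G'$ a dense subgroup of $G$. Let $K\subseteq\widehat{G}$ be compact. Let $E$ be a $G'$-invariant subspace of $\mathcal{L}^2(X,m)\cap\mathcal{L}^\infty(X)$ with a countable core and $E\perp K$. Then $$\lim_n\,\sup_{\chi\in K}\frac{1}{|A_n|}\left|\int_{A_n}f(t.x)\,\overline{\chi(t)}\,dt\right|=0$$ for any $f\in E$ and any $(E,G')$-generic point $x\in X$ (with respect to $\mathcal{A}$).
   Context: $G$ is written additively, with a fixed Haar measure; $|A|$ is the Haar measure of $A\subseteq G$ and $dt$ denotes integration against it. $\widehat{G}$ is the dual group (continuous homomorphisms $G\to\{w\in\mathbb{C}:|w|=1\}$) with its usual locally compact topology. A measurable dynamical system $(X,G,m)$ is a measurable space $(X,\Sigma)$ with a measurable action $G\times X\to X$, $(t,x)\mapsto t.x$, and a $G$-invariant measure $m$ on $(X,\Sigma)$. $\mathcal{L}^2(X,m)$ is the set of measurable functions $f:X\to\mathbb{C}$ (functions, not classes) with $\int_X|f|^2dm<\infty$; $\mathcal{L}^\infty(X)$ is the set of bounded measurable functions on $X$; $L^2(X,m)$ is the Hilbert space of a.e.-classes with $\langle f,g\rangle=\int_X f\overline{g}\,dm$. An eigenfunction to $\chi\in\widehat{G}$ is a nonzero $f\in L^2(X,m)$ with $f(t\,\cdot)=\chi(t)f$ for all $t\in G$; then $\chi$ is an eigenvalue. A Følner sequence is a sequence $(A_n)$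 of open relatively compact subsets of $G$ (in particular $|A_n|>0$) with $\lim_n |A_n\triangle(t+A_n)|/|A_n|=0$ for all $t\in G$. A subspace $E$ is $G'$-invariant if $y\mapsto f(s.y)$ belongs to $E$ for all $f\in E$, $s\in G'$. A subset $F\subseteq E$ is a core for $E$ if every element of $E$ is a uniform limit (w.r.t. $\|g\|_\infty=\sup_{x\in X}|g(x)|$) of a sequence in the linear span of $F$. $E\perp K$ means that every element of $E$ is perpendicular in $L^2(X,m)$ to every eigenfunction to an eigenvalue from $K$. A point $x\in X$ is $(E,G')$-generic with respect to $\mathcal{A}$ if $\int_X f\overline{g}\,dm=\lim_n\frac{1}{|A_n|}\int_{A_n}f(t.x)\overline{g(t.x)}\,dt$ for all $f,g\in E$, and $\lim_n\frac{1}{|A_n|}\int_{A_n\triangle(A_n+s)}|f(t.x)|^2dt=0$ for all $f\in E$, $s\in G'$. *)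

theory Defs
  imports "HOL-Analysis.Analysis" "HOL-Library.Function_Algebras"
begin

definition sigma_compact_group :: "'g::topological_ab_group_add itself \<Rightarrow> bool" where
  "sigma_compact_group _ \<longleftrightarrow>
     (\<exists>C :: nat \<Rightarrow> 'g set. (\<forall>n. compact (C n)) \<and> (\<Union>n. C n) = UNIV)"

definition haar_measure :: "'g::{topological_ab_group_add, t2_space} measure \<Rightarrow> bool" where
  "haar_measure \<mu> \<longleftrightarrow>
     sets \<mu> = sets borel \<and>
     emeasure \<mu> UNIV \<noteq> 0 \<and>
     (\<forall>C. compact C \<longrightarrow> emeasure \<mu> C < \<infinity>) \<and>
     (\<forall>B \<in> sets borel. emeasure \<mu> B = (INF U \<in> {U. open U \<and> B \<subseteq> U}. emeasure \<mu> U)) \<and>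
     (\<forall>U. open U \<longrightarrow>
        emeasure \<mu> U = (SUP C \<in> {C. compact C \<and> C \<subseteq> U}. emeasure \<mu> C)) \<and>
     (\<forall>t. \<forall>B \<in> sets borel. emeasure \<mu> ((+) t ` B) = emeasure \<mu> B)"

definition dense_subgroup :: "'g::topological_ab_group_add set \<Rightarrow> bool" where
  "dense_subgroup H \<longleftrightarrow>
     0 \<in> H \<and> (\<forall>s \<in> H. \<forall>t \<in> H. s + t \<in> H) \<and> (\<forall>s \<in> H. - s \<in> H) \<and> closure H = UNIV"

definition dual_group :: "('g::topological_ab_group_add \<Rightarrow> complex) set" where
  "dual_group = {\<xi>. continuous_on UNIV \<xi> \<and> (\<forall>t. cmod (\<xi> t) = 1) \<and>
                     (\<forall>s t. \<xi> (s + t) = \<xi> s * \<xi> t)}"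

text \<open>The compact-open topology, i.e. uniform convergence on compact sets.\<close>

definition dual_topology :: "('g::topological_ab_group_add \<Rightarrow> complex) topology" where
  "dual_topology = topology_generated_by
     {{\<xi> \<in> dual_group. \<xi> ` C \<subseteq> U} | C U. compact C \<and> open U}"

definition measurable_dynamical_system ::
    "('g::topological_ab_group_add \<Rightarrow> 'x \<Rightarrow> 'x) \<Rightarrow> 'x measure \<Rightarrow> bool" where
  "measurable_dynamical_system act m \<longleftrightarrow>
     (\<lambda>(t, x). act t x) \<in> (borel :: 'g measure) \<Otimes>\<^sub>M m \<rightarrow>\<^sub>M m \<and>
     (\<forall>x \<in> space m. act 0 x = x) \<and>
     (\<forall>s t. \<forall>x \<in> space m. act (s + t) x = act s (act t x)) \<and>
     (\<forall>t. \<forall>B \<in> sets m. emeasure m (act t -` B \<inter> space m) = emeasure m B)"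

text \<open>A function on X is encoded as a function on the whole type that vanishes off X = \<open>space m\<close>,
  so that equality of functions, linear combinations and spans are the ones on X.\<close>

definition functions_on :: "'x measure \<Rightarrow> ('x \<Rightarrow> complex) set" where
  "functions_on m = {f. \<forall>x. x \<notin> space m \<longrightarrow> f x = 0}"

definition translate ::
    "('g \<Rightarrow> 'x \<Rightarrow> 'x) \<Rightarrow> 'x measure \<Rightarrow> 'g \<Rightarrow> ('x \<Rightarrow> complex) \<Rightarrow> 'x \<Rightarrow> complex" where
  "translate act m s f = (\<lambda>y. if y \<in> space m then f (act s y) else 0)"

definition square_integrable :: "'x measure \<Rightarrow> ('x \<Rightarrow> complex) \<Rightarrow> bool" where
  "square_integrable m f \<longleftrightarrow> f \<in> borel_measurable m \<and> integrable m (\<lambda>x. (cmod (f x))\<^sup>2)"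

definition L2_Linf :: "'x measure \<Rightarrow> ('x \<Rightarrow> complex) set" where
  "L2_Linf m = {f \<in> functions_on m. square_integrable m f \<and> bounded (f ` space m)}"

definition fun_scale :: "complex \<Rightarrow> ('x \<Rightarrow> complex) \<Rightarrow> 'x \<Rightarrow> complex" where
  "fun_scale c f = (\<lambda>x. c * f x)"

interpretation complex_fun: vector_space fun_scale
  by unfold_locales (simp_all add: fun_scale_def fun_eq_iff algebra_simps)

definition inner_L2 :: "'x measure \<Rightarrow> ('x \<Rightarrow> complex) \<Rightarrow> ('x \<Rightarrow> complex) \<Rightarrow> complex" where
  "inner_L2 m f g = (LINT x|m. f x * cnj (g x))"

text \<open>Elements of the Hilbert space are handled through representatives.\<close>

definition eigenfunction ::
    "('g \<Rightarrow> 'x \<Rightarrow> 'x) \<Rightarrow> 'x measure \<Rightarrow> ('g \<Rightarrow> complex) \<Rightarrow> ('x \<Rightarrow> complex) \<Rightarrow> bool" where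
  "eigenfunction act m \<xi> h \<longleftrightarrow>
     square_integrable m h \<and> \<not> (AE x in m. h x = 0) \<and>
     (\<forall>t. AE x in m. h (act t x) = \<xi> t * h x)"

definition eigenvalue ::
    "('g::topological_ab_group_add \<Rightarrow> 'x \<Rightarrow> 'x) \<Rightarrow> 'x measure \<Rightarrow> ('g \<Rightarrow> complex) \<Rightarrow> bool" where
  "eigenvalue act m \<xi> \<longleftrightarrow> \<xi> \<in> dual_group \<and> (\<exists>h. eigenfunction act m \<xi> h)"

definition perpendicular ::
    "('g::topological_ab_group_add \<Rightarrow> 'x \<Rightarrow> 'x) \<Rightarrow> 'x measure \<Rightarrow> ('x \<Rightarrow> complex) set \<Rightarrow>
     ('g \<Rightarrow> complex) set \<Rightarrow> bool" where
  "perpendicular act m E K \<longleftrightarrow>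
     (\<forall>f \<in> E. \<forall>\<xi> \<in> K. eigenvalue act m \<xi> \<longrightarrow>
        (\<forall>h. eigenfunction act m \<xi> h \<longrightarrow> inner_L2 m f h = 0))"

definition invariant_under ::
    "('g \<Rightarrow> 'x \<Rightarrow> 'x) \<Rightarrow> 'x measure \<Rightarrow> 'g set \<Rightarrow> ('x \<Rightarrow> complex) set \<Rightarrow> bool" where
  "invariant_under act m H E \<longleftrightarrow> (\<forall>f \<in> E. \<forall>s \<in> H. translate act m s f \<in> E)"

definition core :: "'x measure \<Rightarrow> ('x \<Rightarrow> complex) set \<Rightarrow> ('x \<Rightarrow> complex) set \<Rightarrow> bool" where
  "core m F E \<longleftrightarrow> F \<subseteq> E \<and>
     (\<forall>f \<in> E. \<exists>g :: nat \<Rightarrow> 'x \<Rightarrow> complex.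
        (\<forall>n. g n \<in> complex_fun.span F) \<and> uniform_limit (space m) g f sequentially)"

definition Folner_sequence ::
    "'g::topological_ab_group_add measure \<Rightarrow> (nat \<Rightarrow> 'g set) \<Rightarrow> bool" where
  "Folner_sequence \<mu> A \<longleftrightarrow>
     (\<forall>n. open (A n) \<and> compact (closure (A n)) \<and> 0 < measure \<mu> (A n)) \<and>
     (\<forall>t. (\<lambda>n. measure \<mu> (sym_diff (A n) ((+) t ` A n)) / measure \<mu> (A n)) \<longlonglongrightarrow> 0)"

definition generic ::
    "'g::topological_ab_group_add measure \<Rightarrow> ('g \<Rightarrow> 'x \<Rightarrow> 'x) \<Rightarrow> 'x measure \<Rightarrow>
     (nat \<Rightarrow> 'g set) \<Rightarrow> ('x \<Rightarrow> complex) set \<Rightarrow> 'g set \<Rightarrow> 'x \<Rightarrow> bool" where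
  "generic \<mu> act m A E H x \<longleftrightarrow>
     x \<in> space m \<and>
     (\<forall>f \<in> E. \<forall>g \<in> E.
        (\<lambda>n. (LINT t:A n|\<mu>. f (act t x) * cnj (g (act t x))) / complex_of_real (measure \<mu> (A n)))
          \<longlonglongrightarrow> inner_L2 m f g) \<and>
     (\<forall>f \<in> E. \<forall>s \<in> H.
        (\<lambda>n. (LINT t:sym_diff (A n) ((+) s ` A n)|\<mu>. (cmod (f (act t x)))\<^sup>2) / measure \<mu> (A n))
          \<longlonglongrightarrow> 0)"

end

theory Submission
  imports Defs
begin

text \<open>
  Suppose the suprema do not tend to zero. Then there are characters \<open>\<psi>\<^sub>n \<in> K\<close> for which the averages
  \<open>\<Phi>\<^sub>n(g) = |A\<^sub>n|\<inverse> \<integral>\<^bsub>A\<^sub>n\<^esub> g(t.x) cnj (\<psi>\<^sub>n t) dt\<close> at \<open>g = f\<close> stay away from zero for infinitely many \<open>n\<close>.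
  The set \<open>K\<close> is compact for pointwise convergence and, by Tychonoff's theorem, so is the set of
  functions on \<open>E\<close> obeying the bounds \<open>|\<Phi>\<^sub>n(g)| \<le> sup |g|\<close>. Hence along some filter finer than the
  one of large \<open>n\<close> both \<open>\<psi>\<^sub>n \<rightarrow> \<xi> \<in> K\<close> and \<open>\<Phi>\<^sub>n \<rightarrow> \<phi>\<close> pointwise, and it is enough to show \<open>\<phi>(f) = 0\<close>
  (\<open>limit_functional_vanishes\<close>).

  The limit \<open>\<phi>\<close> is linear on \<open>E\<close>; genericity of \<open>x\<close> bounds it by the \<open>L\<^sup>2\<close> norm; and the Folner property
  gives \<open>\<phi>(g(s.\<cdot>)) = \<xi>(s) \<phi>(g)\<close> for \<open>s \<in> G'\<close>. So \<open>\<phi> = \<langle>\<cdot>, h\<rangle>\<close> for some \<open>h\<close> in the \<open>L\<^sup>2\<close> closure of \<open>E\<close>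
  (\<open>linear_functional_representation\<close>), and the equivariance of \<open>\<phi>\<close> becomes \<open>h(s.\<cdot>) = \<xi>(s) h\<close> for
  \<open>s \<in> G'\<close> (\<open>representative_equivariant\<close>). If this equation holds for all \<open>s \<in> G\<close>, then either
  \<open>h = 0\<close> or \<open>h\<close> is an eigenfunction to \<open>\<xi> \<in> K\<close>, and \<open>E \<perp> K\<close> yields \<open>\<phi>(f) = \<langle>f, h\<rangle> = 0\<close>.

  The passage from the dense subgroup \<open>G'\<close> to \<open>G\<close> (\<open>eigenfunction_equation_extends\<close>) is the delicate point:
  \<open>m\<close> need not be sigma-finite, and translation need not be continuous in \<open>L\<^sup>2(X, m)\<close>, as counting measure
  on the real line shows. Two facts replace continuity. A bounded Borel function on \<open>G\<close>
  that is invariant under \<open>G'\<close> is, for each \<open>r \<in> G\<close>, invariant under \<open>r\<close> almost everywhere on every set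
  of finite measure (\<open>dense_invariant_imp_AE_invariant\<close>). And since the action is jointly measurable, this applies
  to all the functions \<open>t \<mapsto> cnj (\<xi> t) \<integral> 1\<^bsub>B\<^esub>(t.y) w(y) dm(y)\<close>, \<open>w = |h| cnj h\<close>, that are needed, off one common null
  set of \<open>t\<close> in a compact set of positive measure (\<open>twisted_equivariance_extends\<close>).
\<close>

section \<open>Integration preliminaries\<close>

lemma AE_zero_if_set_integrals_zero:
  fixes d :: "'a \<Rightarrow> complex"
  assumes d: "integrable M d"
    and zero: "\<And>B. B \<in> sets M \<Longrightarrow> (LINT x:B|M. d x) = 0"
  shows "AE x in M. d x = 0"
proof -
  have int: "integrable M (\<lambda>x. indicator B x *\<^sub>R d x)" if "B \<in> sets M" for B
    using that d by (rule integrable_mult_indicator)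
  have "(LINT x:B|M. Re (d x)) = (LINT x:B|M. 0)" if "B \<in> sets M" for B
    using integral_Re[OF int[OF that]] zero[OF that] by (simp add: set_lebesgue_integral_def)
  then have "AE x in M. Re (d x) = 0"
    using d by (intro density_unique_real) auto
  moreover have "(LINT x:B|M. Im (d x)) = (LINT x:B|M. 0)" if "B \<in> sets M" for B
    using integral_Im[OF int[OF that]] zero[OF that] by (simp add: set_lebesgue_integral_def)
  then have "AE x in M. Im (d x) = 0"
    using d by (intro density_unique_real) auto
  ultimately show ?thesis
    by eventually_elim (simp add: complex_eq_iff)
qed

lemma norm_integral_le:
  fixes f :: "'a \<Rightarrow> 'b::{banach, second_countable_topology}"
  assumes "integrable M f" "integrable M g" "\<And>x. x \<in> space M \<Longrightarrow> norm (f x) \<le> g x"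
  shows "norm (\<integral>x. f x \<partial>M) \<le> (\<integral>x. g x \<partial>M)"
  by (rule order_trans[OF integral_norm_bound integral_mono]) (use assms in auto)

lemma set_integrable_bounded:
  fixes f :: "'a \<Rightarrow> complex"
  assumes "f \<in> borel_measurable M" "\<And>x. cmod (f x) \<le> c"
    and "B \<in> sets M" "emeasure M B < \<infinity>"
  shows "set_integrable M B f"
  using assms unfolding set_integrable_def
  by (intro integrableI_bounded_set_indicator[where B = c]) auto

lemma cmod_set_integral_diff_le:
  fixes f :: "'a \<Rightarrow> complex"
  assumes f: "f \<in> borel_measurable M" "\<And>x. cmod (f x) \<le> c"
    and C: "C \<in> sets M" "emeasure M C < \<infinity>" and D: "D \<in> sets M" "emeasure M D < \<infinity>"
  shows "cmod ((LINT x:C|M. f x) - (LINT x:D|M. f x)) \<le> c * measure M (sym_diff C D)"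
proof -
  have int: "integrable M (\<lambda>x. indicator C x *\<^sub>R f x)" "integrable M (\<lambda>x. indicator D x *\<^sub>R f x)"
    using set_integrable_bounded[OF f C] set_integrable_bounded[OF f D]
    by (simp_all add: set_integrable_def)
  have "emeasure M (sym_diff C D) \<le> emeasure M C + emeasure M D"
    using C D by (intro order_trans[OF emeasure_mono[of _ "C \<union> D"] emeasure_subadditive]) auto
  then have fin: "emeasure M (sym_diff C D) < \<infinity>"
    using C D by (auto intro: le_less_trans)
  have "(LINT x:C|M. f x) - (LINT x:D|M. f x)
      = (LINT x|M. indicator C x *\<^sub>R f x - indicator D x *\<^sub>R f x)"
    using int by (simp add: set_lebesgue_integral_def)
  also have "cmod \<dots> \<le> (LINT x|M. c * indicator (sym_diff C D) x)"
  proof (rule norm_integral_le)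
    show "integrable M (\<lambda>x. c * indicator (sym_diff C D) x)"
      using C D fin by (intro integrable_mult_right integrable_real_indicator) auto
    show "cmod (indicator C x *\<^sub>R f x - indicator D x *\<^sub>R f x) \<le> c * indicator (sym_diff C D) x" for x
      using f(2)[of x] by (auto simp: indicator_def)
  qed (use int in simp)
  also have "\<dots> = c * measure M (sym_diff C D)"
    using C D by simp
  finally show ?thesis .
qed

section \<open>Haar measure and translations by a dense subgroup\<close>
lemma translate_set_eq_vimage: "(+) s ` B = (+) (- s) -` B" for s :: "'g::ab_group_add"
proof -
  have "x \<in> (+) s ` B" if "- s + x \<in> B" for x
    using that by (intro image_eqI[of _ _ "- s + x"]) simp_all
  then show ?thesis by auto
qed

lemma borel_measurable_translate [measurable]:
  "(+) s \<in> (borel :: 'g::topological_ab_group_add measure) \<rightarrow>\<^sub>M borel"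
  by (intro borel_measurable_continuous_onI continuous_intros)

lemma translate_sets_borel [intro]:
  fixes B :: "'g::topological_ab_group_add set"
  assumes "B \<in> sets borel"
  shows "(+) s ` B \<in> sets borel"
  using measurable_sets[OF borel_measurable_translate assms, of "- s"]
  by (simp add: translate_set_eq_vimage)

lemma haar_sets: "haar_measure \<mu> \<Longrightarrow> sets \<mu> = sets borel"
  by (simp add: haar_measure_def)

lemma haar_space: "haar_measure \<mu> \<Longrightarrow> space \<mu> = UNIV"
  using sets_eq_imp_space_eq[of \<mu> borel] by (simp add: haar_sets)

lemma haar_emeasure_translate:
  "haar_measure \<mu> \<Longrightarrow> B \<in> sets borel \<Longrightarrow> emeasure \<mu> ((+) t ` B) = emeasure \<mu> B"
  unfolding haar_measure_def by blast

lemma haar_outer_regular: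
  "haar_measure \<mu> \<Longrightarrow> B \<in> sets borel \<Longrightarrow>
     emeasure \<mu> B = (INF U \<in> {U. open U \<and> B \<subseteq> U}. emeasure \<mu> U)"
  unfolding haar_measure_def by blast

lemma haar_inner_regular:
  "haar_measure \<mu> \<Longrightarrow> open U \<Longrightarrow>
     emeasure \<mu> U = (SUP C \<in> {C. compact C \<and> C \<subseteq> U}. emeasure \<mu> C)"
  unfolding haar_measure_def by blast

lemma haar_distr_translate:
  assumes "haar_measure \<mu>"
  shows "distr \<mu> \<mu> ((+) s) = \<mu>"
proof (rule measure_eqI)
  fix B assume "B \<in> sets (distr \<mu> \<mu> ((+) s))"
  then have B: "B \<in> sets borel" "B \<in> sets \<mu>"
    using haar_sets[OF assms] by auto
  have "emeasure (distr \<mu> \<mu> ((+) s)) B = emeasure \<mu> ((+) s -` B)"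
    using B haar_sets[OF assms] haar_space[OF assms]
    by (subst emeasure_distr) (auto cong: measurable_cong_sets)
  also have "(+) s -` B = (+) (- s) ` B"
    unfolding translate_set_eq_vimage by simp
  finally show "emeasure (distr \<mu> \<mu> ((+) s)) B = emeasure \<mu> B"
    using haar_emeasure_translate[OF assms B(1), of "- s"] by (simp only:)
qed simp

lemma haar_set_integral_translate:
  fixes f :: "'g::{topological_ab_group_add, t2_space} \<Rightarrow> complex"
  assumes \<mu>: "haar_measure \<mu>" and f: "f \<in> borel_measurable borel" and B: "B \<in> sets borel"
  shows "(LINT t:B|\<mu>. f (s + t)) = (LINT t:(+) s ` B|\<mu>. f t)"
proof -
  have [measurable_cong]: "sets \<mu> = sets borel"
    using \<mu> by (rule haar_sets)
  have [measurable]: "f \<in> borel_measurable borel" "(+) s ` B \<in> sets borel"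
    using f B by auto
  have "(LINT t:(+) s ` B|\<mu>. f t)
      = (LINT t|distr \<mu> \<mu> ((+) s). indicator ((+) s ` B) t *\<^sub>R f t)"
    using haar_distr_translate[OF \<mu>] by (simp add: set_lebesgue_integral_def)
  also have "\<dots> = (LINT t|\<mu>. indicator ((+) s ` B) (s + t) *\<^sub>R f (s + t))"
    by (rule integral_distr) measurable
  also have "\<dots> = (LINT t:B|\<mu>. f (s + t))"
    unfolding set_lebesgue_integral_def by (intro Bochner_Integration.integral_cong) (auto simp: indicator_def)
  finally show ?thesis ..
qed

text \<open>A set of finite measure lies, up to small measure, between a compact \<open>C\<close> and an open \<open>U\<close> that nearly
have its measure; for \<open>v\<close> near \<open>0\<close> compactness gives \<open>v + C \<subseteq> U\<close>, so \<open>v + B\<close> sticks out of \<open>B\<close> only a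
little. Using \<open>-v\<close> as well controls the other half of the symmetric difference.\<close>
lemma haar_translation_continuous:
  fixes B :: "'g::{topological_ab_group_add, t2_space} set"
  assumes \<mu>: "haar_measure \<mu>" and B: "B \<in> sets borel" and fin: "emeasure \<mu> B < \<infinity>" and e: "0 < e"
  shows "\<exists>V. open V \<and> 0 \<in> V \<and> (\<forall>v\<in>V. emeasure \<mu> (sym_diff B ((+) v ` B)) \<le> ennreal e)"
proof -
  have [measurable_cong, simp]: "sets \<mu> = sets borel"
    using \<mu> by (rule haar_sets)
  define d where "d = ennreal (e / 4)"
  have d: "0 < d" "d < \<infinity>" using e by (auto simp: d_def)
  have "(INF U \<in> {U. open U \<and> B \<subseteq> U}. emeasure \<mu> U) = emeasure \<mu> B"
    using haar_outer_regular[OF \<mu> B] ..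
  also have "\<dots> < emeasure \<mu> B + d"
    using fin d ennreal_add_left_cancel_less[of "emeasure \<mu> B" 0 d] by simp
  finally obtain U where U: "open U" "B \<subseteq> U" "emeasure \<mu> U < emeasure \<mu> B + d"
    by (auto simp: INF_less_iff)
  have finU: "emeasure \<mu> U < \<infinity>"
    using U(3) fin d by (auto intro: less_trans)
  have "\<exists>C. compact C \<and> C \<subseteq> U \<and> emeasure \<mu> U \<le> emeasure \<mu> C + d"
  proof (cases "emeasure \<mu> U \<le> d")
    case True
    then show ?thesis by (intro exI[of _ "{}"]) auto
  next
    case False
    have "emeasure \<mu> U - d < emeasure \<mu> U"
      using False d finU by (intro ennreal_between) auto
    also have "\<dots> = (SUP C \<in> {C. compact C \<and> C \<subseteq> U}. emeasure \<mu> C)"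
      using haar_inner_regular[OF \<mu> U(1)] .
    finally obtain C where "compact C" "C \<subseteq> U" "emeasure \<mu> U - d < emeasure \<mu> C"
      by (auto simp: less_SUP_iff)
    then show ?thesis
      by (intro exI[of _ C]) (auto simp: ennreal_minus_le_iff add.commute dest: less_imp_le)
  qed
  then obtain C where C: "compact C" "C \<subseteq> U" "emeasure \<mu> U \<le> emeasure \<mu> C + d"
    by blast
  have [measurable]: "U \<in> sets borel" "C \<in> sets borel" "B \<in> sets borel"
    using U(1) C(1) B by (auto intro: borel_closed compact_imp_closed)
  have UB: "emeasure \<mu> (U - B) \<le> d"
    using U fin by (subst emeasure_Diff) (auto simp: ennreal_minus_le_iff dest: less_imp_le)
  have UC: "emeasure \<mu> (U - C) \<le> d"
    using C finU emeasure_mono[OF C(2), of \<mu>]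
    by (subst emeasure_Diff) (auto simp: ennreal_minus_le_iff top_unique)
  have "open {p. fst p + snd p \<in> U}"
  proof -
    have "continuous_on UNIV (\<lambda>p::'g \<times> 'g. fst p + snd p)"
      by (intro continuous_intros)
    from open_vimage[OF U(1) this] show ?thesis by (simp add: vimage_def)
  qed
  then obtain V where V: "0 \<in> V" "open V" "V \<times> C \<subseteq> {p. fst p + snd p \<in> U}"
    using Elementary_Topology.tube_lemma[OF C(1), of "{p. fst p + snd p \<in> U}" 0] C(2) by force
  have half: "emeasure \<mu> ((+) v ` B - B) \<le> d + d" if v: "v \<in> V" for v
  proof -
    have "(+) v ` B - B \<subseteq> ((+) v ` (U - C)) \<union> (U - B)"
    proof
      fix y assume "y \<in> (+) v ` B - B"
      then obtain b where b: "y = v + b" "b \<in> B" "y \<notin> B" by blast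
      show "y \<in> (+) v ` (U - C) \<union> (U - B)"
      proof (cases "b \<in> C")
        case True
        then have "(v, b) \<in> V \<times> C" using v by simp
        then show ?thesis using V(3) b by auto
      next
        case False
        then show ?thesis using U(2) b by auto
      qed
    qed
    then have "emeasure \<mu> ((+) v ` B - B) \<le> emeasure \<mu> (((+) v ` (U - C)) \<union> (U - B))"
      by (intro emeasure_mono) (auto intro!: translate_sets_borel)
    also have "\<dots> \<le> emeasure \<mu> ((+) v ` (U - C)) + emeasure \<mu> (U - B)"
      by (intro emeasure_subadditive) (auto intro!: translate_sets_borel)
    also have "emeasure \<mu> ((+) v ` (U - C)) = emeasure \<mu> (U - C)"
      by (intro haar_emeasure_translate[OF \<mu>]) measurable
    finally show ?thesis
      using UB UC by (meson add_mono order_trans)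
  qed
  define W where "W = V \<inter> uminus -` V"
  have "open W"
    unfolding W_def using V(2) by (intro open_Int open_vimage) (auto intro!: continuous_intros)
  moreover have "0 \<in> W" using V(1) by (simp add: W_def)
  moreover have "emeasure \<mu> (sym_diff B ((+) v ` B)) \<le> ennreal e" if v: "v \<in> W" for v
  proof -
    \<comment> \<open>The part of \<open>B\<close> outside \<open>v + B\<close> is a translate of the part of \<open>-v + B\<close> outside \<open>B\<close>.\<close>
    have "B - (+) v ` B = (+) v ` ((+) (- v) ` B - B)"
      by (force simp: image_iff)
    moreover have "(+) (- v) ` B - B \<in> sets borel"
      using B translate_sets_borel[OF B, of "- v"] by (intro sets.Diff)
    ultimately have "emeasure \<mu> (B - (+) v ` B) = emeasure \<mu> ((+) (- v) ` B - B)"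
      using haar_emeasure_translate[OF \<mu>, of "(+) (- v) ` B - B" v] by (simp only:)
    then have "emeasure \<mu> (B - (+) v ` B) \<le> d + d"
      using half[of "- v"] v by (simp add: W_def)
    moreover have "emeasure \<mu> ((+) v ` B - B) \<le> d + d"
      using half[of v] v by (simp add: W_def)
    moreover have "emeasure \<mu> (sym_diff B ((+) v ` B))
        \<le> emeasure \<mu> (B - (+) v ` B) + emeasure \<mu> ((+) v ` B - B)"
      by (intro emeasure_subadditive) (auto intro!: translate_sets_borel)
    moreover have "(d + d) + (d + d) = ennreal e"
      using e by (simp add: d_def flip: ennreal_plus)
    ultimately show ?thesis
      by (metis add_mono order_trans)
  qed
  ultimately show ?thesis by blast
qed

text \<open>The map \<open>s \<mapsto> \<integral>\<^bsub>s + B\<^esub> a\<close> is constant on \<open>H\<close>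
and continuous, hence constant, for every \<open>B\<close> of finite measure. The restriction to \<open>B0\<close> makes
the difference \<open>a (r + t) - a t\<close> integrable. Testing against sets keeps the argument within \<open>G\<close>; Fubini on
\<open>G \<times> G\<close> is problematic because addition may fail to be measurable for the product of the Borel algebras
when \<open>G\<close> is not second countable.\<close>
lemma dense_invariant_imp_AE_invariant:
  fixes a :: "'g::{topological_ab_group_add, t2_space} \<Rightarrow> complex"
  assumes \<mu>: "haar_measure \<mu>" and H: "dense_subgroup H"
    and a: "a \<in> borel_measurable borel" and bound: "\<And>t. cmod (a t) \<le> M"
    and inv: "\<And>s t. s \<in> H \<Longrightarrow> a (s + t) = a t"
    and B0: "B0 \<in> sets borel" "emeasure \<mu> B0 < \<infinity>"
  shows "AE t in \<mu>. t \<in> B0 \<longrightarrow> a (r + t) = a t"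
proof -
  have [measurable_cong, simp]: "sets \<mu> = sets borel"
    using \<mu> by (rule haar_sets)
  have [measurable]: "a \<in> borel_measurable borel" "B0 \<in> sets borel"
    using a B0 by auto
  have si: "set_integrable \<mu> B (\<lambda>t. a (s + t))" if "B \<in> sets borel" "emeasure \<mu> B < \<infinity>" for B s
    using that bound by (intro set_integrable_bounded[where c = M]) auto
  have M: "0 \<le> M" using bound[of 0] norm_ge_zero order_trans by blast
  have main: "(LINT t:B|\<mu>. a (r + t)) = (LINT t:B|\<mu>. a t)"
    if B: "B \<in> sets borel" "emeasure \<mu> B < \<infinity>" for B
  proof -
    define C where "C = (+) r ` B"
    have C: "C \<in> sets borel" "emeasure \<mu> C < \<infinity>"
      using B haar_emeasure_translate[OF \<mu> B(1), of r] by (auto simp: C_def translate_sets_borel)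
    have near: "cmod ((LINT t:C|\<mu>. a t) - (LINT t:B|\<mu>. a t)) \<le> M * e" if e: "e > 0" for e
    proof -
      obtain V where V: "open V" "0 \<in> V"
        "\<And>v. v \<in> V \<Longrightarrow> emeasure \<mu> (sym_diff C ((+) v ` C)) \<le> ennreal e"
        using haar_translation_continuous[OF \<mu> C e] by blast
      have "open ((\<lambda>s. s - r) -` V)"
        using V(1) by (intro open_vimage) (auto intro!: continuous_intros)
      moreover have "r \<in> (\<lambda>s. s - r) -` V"
        using V(2) by simp
      ultimately have "(\<lambda>s. s - r) -` V \<inter> H \<noteq> {}"
        using H open_Int_closure_eq_empty[of "(\<lambda>s. s - r) -` V" H]
        unfolding dense_subgroup_def by blast
      then obtain s where s: "s \<in> H" "s - r \<in> V"
        by auto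
      define D where "D = (+) s ` B"
      have D: "D \<in> sets borel" "emeasure \<mu> D < \<infinity>"
        using B haar_emeasure_translate[OF \<mu> B(1), of s] by (auto simp: D_def translate_sets_borel)
      have "(+) (s - r) ` C = D"
        by (auto simp: C_def D_def image_image algebra_simps)
      then have small: "emeasure \<mu> (sym_diff C D) \<le> ennreal e"
        using V(3)[OF s(2)] by simp
      have "(LINT t:D|\<mu>. a t) = (LINT t:B|\<mu>. a t)"
        unfolding D_def using haar_set_integral_translate[OF \<mu> a B(1), of s] inv[OF s(1)] by simp
      then have "cmod ((LINT t:C|\<mu>. a t) - (LINT t:B|\<mu>. a t)) \<le> M * measure \<mu> (sym_diff C D)"
        using cmod_set_integral_diff_le[of a \<mu> M C D] bound C D by simp
      also have "\<dots> \<le> M * e"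
        using M small e by (intro mult_left_mono) (auto simp: measure_def enn2real_leI)
      finally show ?thesis .
    qed
    then have "cmod ((LINT t:C|\<mu>. a t) - (LINT t:B|\<mu>. a t)) \<le> 0 + e" if "e > 0" for e
    proof -
      have "M * (e / (M + 1)) \<le> e"
        using that M by (simp add: field_simps)
      moreover have "0 < e / (M + 1)"
        using that M by simp
      ultimately show ?thesis
        using near[of "e / (M + 1)"] by linarith
    qed
    then have "cmod ((LINT t:C|\<mu>. a t) - (LINT t:B|\<mu>. a t)) \<le> 0"
      by (rule field_le_epsilon)
    then show ?thesis
      using haar_set_integral_translate[OF \<mu> a B(1), of r] by (simp add: C_def)
  qed
  have "AE t in \<mu>. indicator B0 t *\<^sub>R (a (r + t) - a t) = 0"
  proof (rule AE_zero_if_set_integrals_zero)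
    show "integrable \<mu> (\<lambda>t. indicator B0 t *\<^sub>R (a (r + t) - a t))"
      using set_integral_diff(1)[OF si[OF B0] si[OF B0, of 0]] by (simp add: set_integrable_def)
    fix B assume "B \<in> sets \<mu>"
    then have BB: "B \<inter> B0 \<in> sets borel" "emeasure \<mu> (B \<inter> B0) < \<infinity>"
      using B0 by (auto intro: le_less_trans[OF emeasure_mono])
    have "(LINT t:B|\<mu>. indicator B0 t *\<^sub>R (a (r + t) - a t)) = (LINT t:B \<inter> B0|\<mu>. a (r + t) - a t)"
      by (simp add: set_lebesgue_integral_def indicator_inter_arith mult.assoc)
    also have "\<dots> = 0"
      using set_integral_diff(2)[OF si[OF BB] si[OF BB, of 0]] main[OF BB] by simp
    finally show "(LINT t:B|\<mu>. indicator B0 t *\<^sub>R (a (r + t) - a t)) = 0" .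
  qed
  then show ?thesis
    by eventually_elim auto
qed

section \<open>Square integrable functions\<close>
lemma borel_measurable_cnj [measurable (raw)]:
  "f \<in> borel_measurable M \<Longrightarrow> (\<lambda>x. cnj (f x)) \<in> borel_measurable M"
  by (rule measurable_compose[OF _ borel_measurable_continuous_onI[OF continuous_on_cnj]])
     (auto intro: continuous_on_id)

lemma square_integrable_norm_sq: "square_integrable m f \<Longrightarrow> integrable m (\<lambda>x. (cmod (f x))\<^sup>2)"
  by (simp add: square_integrable_def)

lemma cmod_add_sq_le: "(cmod (a + b))\<^sup>2 \<le> 2 * (cmod a)\<^sup>2 + 2 * (cmod b)\<^sup>2"
proof -
  have "(cmod (a + b))\<^sup>2 \<le> (cmod a + cmod b)\<^sup>2"
    by (intro power_mono norm_triangle_ineq) simp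
  also have "\<dots> \<le> 2 * (cmod a)\<^sup>2 + 2 * (cmod b)\<^sup>2"
    using sum_squares_bound[of "cmod a" "cmod b"] by (simp add: power2_sum)
  finally show ?thesis .
qed

lemma square_integrable_add:
  assumes "square_integrable m f" "square_integrable m g"
  shows "square_integrable m (\<lambda>x. f x + g x)"
proof -
  have [measurable]: "f \<in> borel_measurable m" "g \<in> borel_measurable m"
    using assms by (simp_all add: square_integrable_def)
  have "integrable m (\<lambda>x. 2 * (cmod (f x))\<^sup>2 + 2 * (cmod (g x))\<^sup>2)"
    using assms by (simp add: square_integrable_def)
  then have "integrable m (\<lambda>x. (cmod (f x + g x))\<^sup>2)"
    by (rule Bochner_Integration.integrable_bound) (auto simp: cmod_add_sq_le)
  then show ?thesis
    by (simp add: square_integrable_def)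
qed

lemma square_integrable_scale:
  "square_integrable m f \<Longrightarrow> square_integrable m (\<lambda>x. c * f x)"
  by (auto simp: square_integrable_def norm_mult power_mult_distrib)

lemma square_integrable_diff:
  assumes "square_integrable m f" "square_integrable m g"
  shows "square_integrable m (\<lambda>x. f x - g x)"
  using square_integrable_add[OF assms(1) square_integrable_scale[OF assms(2), of "-1"]] by simp

lemma square_integrable_mult_cnj:
  assumes "square_integrable m f" "square_integrable m g"
  shows "integrable m (\<lambda>x. f x * cnj (g x))"
proof -
  have [measurable]: "f \<in> borel_measurable m" "g \<in> borel_measurable m"
    using assms by (simp_all add: square_integrable_def)
  have "integrable m (\<lambda>x. (cmod (f x))\<^sup>2 + (cmod (g x))\<^sup>2)"
    using assms by (simp add: square_integrable_def)
  then show ?thesis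
  proof (rule Bochner_Integration.integrable_bound)
    have "cmod (f x) * cmod (g x) \<le> (cmod (f x))\<^sup>2 + (cmod (g x))\<^sup>2" for x
      using sum_squares_bound[of "cmod (f x)" "cmod (g x)"]
        mult_nonneg_nonneg[OF norm_ge_zero[of "f x"] norm_ge_zero[of "g x"]] by linarith
    then show "AE x in m. norm (f x * cnj (g x)) \<le> norm ((cmod (f x))\<^sup>2 + (cmod (g x))\<^sup>2)"
      by (simp add: norm_mult)
  qed measurable
qed

definition norm_sq :: "'x measure \<Rightarrow> ('x \<Rightarrow> complex) \<Rightarrow> real" where
  "norm_sq m f = (LINT x|m. (cmod (f x))\<^sup>2)"

lemma norm_sq_nonneg: "0 \<le> norm_sq m f"
  by (simp add: norm_sq_def)

lemma inner_L2_self: "inner_L2 m f f = complex_of_real (norm_sq m f)"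
  by (simp add: inner_L2_def norm_sq_def complex_norm_square[symmetric] flip: integral_complex_of_real)

lemma norm_sq_add_scale:
  assumes f: "square_integrable m f" and g: "square_integrable m g"
  shows "norm_sq m (\<lambda>x. f x + c * g x)
       = norm_sq m f + 2 * Re (c * inner_L2 m g f) + (cmod c)\<^sup>2 * norm_sq m g"
proof -
  have "(cmod (f x + c * g x))\<^sup>2
      = (cmod (f x))\<^sup>2 + 2 * Re (c * (g x * cnj (f x))) + (cmod c)\<^sup>2 * (cmod (g x))\<^sup>2" for x
    unfolding cmod_power2 by (simp add: power2_eq_square algebra_simps)
  moreover have int: "integrable m (\<lambda>x. c * (g x * cnj (f x)))"
    by (intro integrable_mult_right square_integrable_mult_cnj f g)
  moreover have "(LINT x|m. Re (c * (g x * cnj (f x)))) = Re (c * inner_L2 m g f)"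
    unfolding inner_L2_def using integral_Re[OF int] by simp
  ultimately show ?thesis
    using f g integrable_Re[OF int]
    by (simp add: norm_sq_def square_integrable_def del: Re_complex_of_real times_complex.sel)
qed

lemma norm_sq_scale: "norm_sq m (\<lambda>x. c * f x) = (cmod c)\<^sup>2 * norm_sq m f"
  by (simp add: norm_sq_def norm_mult power_mult_distrib)

lemma norm_sq_eq_0_iff:
  assumes "square_integrable m f"
  shows "norm_sq m f = 0 \<longleftrightarrow> (AE x in m. f x = 0)"
  unfolding norm_sq_def using assms
  by (subst integral_nonneg_eq_0_iff_AE) (auto simp: square_integrable_def)

text \<open>Riesz-Fischer for rapidly converging sequences. The weight \<open>2 ^ k\<close> makes \<open>\<Sum>k. 2 ^ k * |g\<^sub>k - g\<^bsub>k+1\<^esub>|\<^sup>2\<close>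
integrable, hence finite almost everywhere, while \<open>|d| \<le> 2\<^bsup>-k\<^esup> + 2\<^sup>k |d|\<^sup>2\<close> turns its
finiteness into absolute convergence of the telescoping series. Fatou's lemma gives the estimate for the limit.\<close>
lemma L2_complete_fast:
  fixes g :: "nat \<Rightarrow> 'x \<Rightarrow> complex"
  assumes sq: "\<And>k. square_integrable m (g k)"
    and fast: "\<And>k l. k \<le> l \<Longrightarrow> norm_sq m (\<lambda>x. g k x - g l x) \<le> (1 / 4) ^ k"
  obtains h where "square_integrable m h"
    and "\<And>k. norm_sq m (\<lambda>x. g k x - h x) \<le> (1 / 4) ^ k"
proof -
  have [measurable]: "g k \<in> borel_measurable m" for k
    using sq by (simp add: square_integrable_def)
  have nn: "(\<integral>\<^sup>+ x. ennreal ((cmod (g k x - g l x))\<^sup>2) \<partial>m) \<le> ennreal ((1 / 4) ^ k)"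
    if "k \<le> l" for k l
    using fast[OF that] square_integrable_diff[OF sq[of k] sq[of l]]
    by (subst nn_integral_eq_integral) (auto simp: square_integrable_def norm_sq_def)
  define d where "d k x = (cmod (g k x - g (Suc k) x))\<^sup>2" for k x
  have [measurable]: "d k \<in> borel_measurable m" for k
    unfolding d_def by measurable
  have "(\<integral>\<^sup>+ x. (\<Sum>k. ennreal (2 ^ k * d k x)) \<partial>m) = (\<Sum>k. \<integral>\<^sup>+ x. ennreal (2 ^ k * d k x) \<partial>m)"
    by (intro nn_integral_suminf) measurable
  also have "\<dots> \<le> (\<Sum>k. ennreal ((1 / 2) ^ k))"
  proof (intro suminf_le allI)
    fix k
    have "(\<integral>\<^sup>+ x. ennreal (2 ^ k * d k x) \<partial>m) = ennreal (2 ^ k) * (\<integral>\<^sup>+ x. ennreal (d k x) \<partial>m)"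
      by (subst nn_integral_cmult[symmetric]) (auto simp: ennreal_mult d_def)
    also have "\<dots> \<le> ennreal (2 ^ k) * ennreal ((1 / 4) ^ k)"
      using nn[of k "Suc k"] by (intro mult_left_mono) (auto simp: d_def)
    also have "\<dots> = ennreal ((1 / 2) ^ k)"
      by (simp add: ennreal_mult[symmetric] power_mult_distrib[symmetric])
    finally show "(\<integral>\<^sup>+ x. ennreal (2 ^ k * d k x) \<partial>m) \<le> ennreal ((1 / 2) ^ k)" .
  qed auto
  also have "\<dots> = ennreal (\<Sum>k. (1 / 2) ^ k)"
    by (intro suminf_ennreal2) (auto intro: summable_geometric)
  also have "\<dots> < \<infinity>" by simp
  finally have "AE x in m. (\<Sum>k. ennreal (2 ^ k * d k x)) \<noteq> \<infinity>"
    by (intro nn_integral_PInf_AE) auto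
  then have conv: "AE x in m. (\<lambda>k. g k x) \<longlonglongrightarrow> lim (\<lambda>k. g k x)"
  proof eventually_elim
    case (elim x)
    have "summable (\<lambda>k. 2 ^ k * d k x)"
      using elim by (intro summable_suminf_not_top) (auto simp: d_def)
    then have "summable (\<lambda>k. (1 / 2) ^ k + 2 ^ k * d k x)"
      by (intro summable_add summable_geometric) auto
    then have "summable (\<lambda>k. g (Suc k) x - g k x)"
    proof (rule summable_comparison_test[rotated], intro exI allI impI)
      fix k :: nat
      have "norm (g (Suc k) x - g k x) = sqrt ((1 / 2) ^ k * (2 ^ k * d k x))"
        by (simp add: d_def norm_minus_commute power_divide)
      also have "\<dots> \<le> ((1 / 2) ^ k + 2 ^ k * d k x) / 2"
        by (intro arith_geo_mean_sqrt) (auto simp: d_def)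
      also have "\<dots> \<le> (1 / 2) ^ k + 2 ^ k * d k x"
        by (simp add: d_def)
      finally show "norm (g (Suc k) x - g k x) \<le> (1 / 2) ^ k + 2 ^ k * d k x" .
    qed
    then have "convergent (\<lambda>n. (\<Sum>k<n. g (Suc k) x - g k x) + g 0 x)"
      by (intro convergent_add convergent_const) (simp add: summable_iff_convergent)
    moreover have "(\<lambda>n. (\<Sum>k<n. g (Suc k) x - g k x) + g 0 x) = (\<lambda>n. g n x)"
      by (subst sum_lessThan_telescope) simp
    ultimately show ?case
      by (simp add: convergent_LIMSEQ_iff)
  qed
  define h where "h x = lim (\<lambda>k. g k x)" for x
  have [measurable]: "h \<in> borel_measurable m"
    unfolding h_def by measurable
  have lim: "(\<integral>\<^sup>+ x. ennreal ((cmod (g k x - h x))\<^sup>2) \<partial>m) \<le> ennreal ((1 / 4) ^ k)" for k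
  proof -
    have "(\<integral>\<^sup>+ x. ennreal ((cmod (g k x - h x))\<^sup>2) \<partial>m)
        = (\<integral>\<^sup>+ x. liminf (\<lambda>l. ennreal ((cmod (g k x - g l x))\<^sup>2)) \<partial>m)"
    proof (rule nn_integral_cong_AE, use conv in eventually_elim)
      case (elim x)
      then have "(\<lambda>l. ennreal ((cmod (g k x - g l x))\<^sup>2)) \<longlonglongrightarrow> ennreal ((cmod (g k x - h x))\<^sup>2)"
        unfolding h_def by (intro tendsto_intros)
      then show ?case
        by (rule lim_imp_Liminf[OF trivial_limit_sequentially, symmetric])
    qed
    also have "\<dots> \<le> liminf (\<lambda>l. \<integral>\<^sup>+ x. ennreal ((cmod (g k x - g l x))\<^sup>2) \<partial>m)"
      by (intro nn_integral_liminf) measurable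
    also have "\<dots> \<le> limsup (\<lambda>l. \<integral>\<^sup>+ x. ennreal ((cmod (g k x - g l x))\<^sup>2) \<partial>m)"
      by (intro Liminf_le_Limsup) simp
    also have "\<dots> \<le> ennreal ((1 / 4) ^ k)"
      by (intro Limsup_bounded eventually_sequentiallyI[of k] nn)
    finally show ?thesis .
  qed
  have diff: "square_integrable m (\<lambda>x. g k x - h x)" for k
    unfolding square_integrable_def
    using lim[of k] by (auto intro!: integrableI_bounded simp: le_less_trans)
  have "norm_sq m (\<lambda>x. g k x - h x) \<le> (1 / 4) ^ k" for k
    using lim[of k] diff[of k]
    by (subst (asm) nn_integral_eq_integral) (auto simp: square_integrable_def norm_sq_def)
  moreover have "square_integrable m h"
    using square_integrable_diff[OF sq[of 0] diff[of 0]] by simp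
  ultimately show ?thesis
    using that by blast
qed

text \<open>The Cauchy-Schwarz inequality in its additive form.\<close>
lemma norm_inner_L2_le:
  assumes f: "square_integrable m f" and g: "square_integrable m g" and "0 < e"
  shows "2 * cmod (inner_L2 m f g) \<le> e * norm_sq m f + norm_sq m g / e"
proof -
  have "2 * (cmod a * cmod b) \<le> e * (cmod a)\<^sup>2 + (cmod b)\<^sup>2 / e" for a b :: complex
  proof -
    have "0 \<le> (e * cmod a - cmod b)\<^sup>2 / e" using \<open>0 < e\<close> by simp
    also have "\<dots> = e * (cmod a)\<^sup>2 + (cmod b)\<^sup>2 / e - 2 * (cmod a * cmod b)"
      using \<open>0 < e\<close> by (simp add: power2_eq_square field_simps)
    finally show ?thesis by simp
  qed
  then have pw: "2 * norm (f x * cnj (g x)) \<le> e * (cmod (f x))\<^sup>2 + (cmod (g x))\<^sup>2 / e" for x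
    by (simp add: norm_mult)
  have "2 * cmod (inner_L2 m f g) \<le> 2 * (LINT x|m. norm (f x * cnj (g x)))"
    unfolding inner_L2_def by (simp add: integral_norm_bound)
  also have "\<dots> = (LINT x|m. 2 * norm (f x * cnj (g x)))"
    by simp
  also have "\<dots> \<le> (LINT x|m. e * (cmod (f x))\<^sup>2 + (cmod (g x))\<^sup>2 / e)"
    using f g square_integrable_mult_cnj[OF f g] pw
    by (intro integral_mono) (auto simp: square_integrable_def)
  also have "\<dots> = e * norm_sq m f + norm_sq m g / e"
    using f g by (simp add: norm_sq_def square_integrable_def)
  finally show ?thesis .
qed

section \<open>Extending equivariance from a dense subgroup\<close>
lemma act_measurable:
  assumes "measurable_dynamical_system act m"
  shows "act t \<in> m \<rightarrow>\<^sub>M m"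
proof -
  have "(\<lambda>(t, x). act t x) \<in> borel \<Otimes>\<^sub>M m \<rightarrow>\<^sub>M m"
    using assms by (simp add: measurable_dynamical_system_def)
  from measurable_compose[OF measurable_Pair1'[of t borel m] this]
  show ?thesis by simp
qed

lemma orbit_measurable:
  assumes "measurable_dynamical_system act m" "x \<in> space m"
  shows "(\<lambda>t. act t x) \<in> borel \<rightarrow>\<^sub>M m"
proof -
  have "(\<lambda>(t, x). act t x) \<in> borel \<Otimes>\<^sub>M m \<rightarrow>\<^sub>M m"
    using assms by (simp add: measurable_dynamical_system_def)
  from measurable_compose[OF measurable_Pair2'[OF assms(2), of borel] this]
  show ?thesis by simp
qed

lemma act_space:
  "measurable_dynamical_system act m \<Longrightarrow> x \<in> space m \<Longrightarrow> act t x \<in> space m"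
  using act_measurable[of act m t] by (rule measurable_space)

lemma act_add:
  "measurable_dynamical_system act m \<Longrightarrow> x \<in> space m \<Longrightarrow> act (s + t) x = act s (act t x)"
  by (simp add: measurable_dynamical_system_def)

lemma act_zero:
  "measurable_dynamical_system act m \<Longrightarrow> x \<in> space m \<Longrightarrow> act 0 x = x"
  by (simp add: measurable_dynamical_system_def)

lemma distr_act:
  assumes "measurable_dynamical_system act m"
  shows "distr m m (act t) = m"
proof (rule measure_eqI)
  fix B assume "B \<in> sets (distr m m (act t))"
  then show "emeasure (distr m m (act t)) B = emeasure m B"
    using assms act_measurable[OF assms, of t]
    by (simp add: emeasure_distr measurable_dynamical_system_def)
qed simp

lemma integral_act:
  fixes f :: "'x \<Rightarrow> 'b::{banach, second_countable_topology}"
  assumes "measurable_dynamical_system act m" "f \<in> borel_measurable m"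
  shows "(LINT x|m. f (act t x)) = (LINT x|m. f x)"
  using integral_distr[OF act_measurable[OF assms(1), of t] assms(2)] distr_act[OF assms(1), of t]
  by simp

lemma integrable_act:
  fixes f :: "'x \<Rightarrow> 'b::{banach, second_countable_topology}"
  assumes "measurable_dynamical_system act m" "integrable m f"
  shows "integrable m (\<lambda>x. f (act t x))"
  using integrable_distr[OF act_measurable[OF assms(1), of t], of f] distr_act[OF assms(1), of t] assms(2)
  by simp

lemma dual_group_add: "\<xi> \<in> dual_group \<Longrightarrow> \<xi> (s + t) = \<xi> s * \<xi> t"
  by (simp add: dual_group_def)

lemma dual_group_norm: "\<xi> \<in> dual_group \<Longrightarrow> cmod (\<xi> t) = 1"
  by (simp add: dual_group_def)

lemma dual_group_mult_cnj: "\<xi> \<in> dual_group \<Longrightarrow> \<xi> t * cnj (\<xi> t) = 1"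
  by (simp add: complex_norm_square[symmetric] dual_group_norm)

lemma dual_group_measurable:
  "\<xi> \<in> dual_group \<Longrightarrow> \<xi> \<in> borel_measurable borel"
  by (intro borel_measurable_continuous_onI) (simp add: dual_group_def)

lemma haar_positive_compact:
  assumes \<mu>: "haar_measure \<mu>"
  obtains C where "compact C" "emeasure \<mu> C \<noteq> 0" "emeasure \<mu> C < \<infinity>"
proof -
  have "0 < emeasure \<mu> UNIV"
    using \<mu> unfolding haar_measure_def zero_less_iff_neq_zero by blast
  then obtain C where "compact C" "0 < emeasure \<mu> C"
    unfolding haar_inner_regular[OF \<mu> open_UNIV] less_SUP_iff by blast
  moreover have "emeasure \<mu> C < \<infinity>"
    using \<mu> \<open>compact C\<close> unfolding haar_measure_def by blast
  ultimately show ?thesis using that by (simp add: zero_less_iff_neq_zero)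
qed

text \<open>For measurable \<open>B\<close> the function \<open>L t B = cnj (\<xi> t) \<integral> 1\<^bsub>B\<^esub>(t.y) w(y) dm(y)\<close> of \<open>t\<close> is bounded, Borel and invariant
under \<open>H\<close>, so \<open>L (r + t) B = L t B\<close> for almost every \<open>t\<close>. Choosing \<open>B\<close> as the preimage of a given set
under \<open>-(r + t)\<close> would turn this into the claim, but then \<open>B\<close> depends on \<open>t\<close>. The way out is to prove the identity
for almost every \<open>t\<close> simultaneously for all sections \<open>B\<close> of a measurable set \<open>S \<subseteq> G \<times> X\<close>:
a rectangle has only one nonempty section, and the property passes to complements and countable
disjoint unions. Joint measurability of the action says that the sets \<open>{y. u.y \<in> B}\<close>, \<open>u \<in> G\<close>, are such
sections.\<close>
lemma twisted_equivariance_extends: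
  fixes act :: "'g::{topological_ab_group_add, t2_space} \<Rightarrow> 'x \<Rightarrow> 'x"
  assumes \<mu>: "haar_measure (\<mu> :: 'g measure)" and sys: "measurable_dynamical_system act m"
    and H: "dense_subgroup H" and \<xi>: "\<xi> \<in> dual_group"
    and w: "integrable m w"
    and eq: "\<And>s. s \<in> H \<Longrightarrow> AE x in m. w x = \<xi> s * w (act s x)"
  shows "AE x in m. w x = \<xi> r * w (act r x)"
proof -
  have [measurable_cong, simp]: "sets \<mu> = sets borel"
    using \<mu> by (rule haar_sets)
  have [measurable]: "w \<in> borel_measurable m" "\<xi> \<in> borel_measurable borel" "act t \<in> m \<rightarrow>\<^sub>M m" 
     "(\<lambda>(t, x). act t x) \<in> borel \<Otimes>\<^sub>M m \<rightarrow>\<^sub>M m" for t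
    using w dual_group_measurable[OF \<xi>] act_measurable[OF sys] sys
    by (auto simp: measurable_dynamical_system_def)
  have mact[measurable (raw)]: "(\<lambda>x. act (f x) (g x)) \<in> M \<rightarrow>\<^sub>M m"
    if "f \<in> M \<rightarrow>\<^sub>M borel" "g \<in> M \<rightarrow>\<^sub>M m" for f g and M :: "'z measure"
    using measurable_compose[OF measurable_Pair[OF that], of "\<lambda>(t, x). act t x" m] by simp
  define I where "I t B = (LINT x|m. indicator B (act t x) *\<^sub>R w x)" for t B
  define L where "L t B = cnj (\<xi> t) * I t B" for t B
  have int: "integrable m (\<lambda>x. indicator B (act t x) *\<^sub>R w x)" if [measurable]: "B \<in> sets m" for B t
    by (rule Bochner_Integration.integrable_bound[OF w]) (auto simp: indicator_def)
  obtain B0 where B0: "compact B0" "emeasure \<mu> B0 \<noteq> 0" "emeasure \<mu> B0 < \<infinity>"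
    using haar_positive_compact[OF \<mu>] .
  have B0_sets: "B0 \<in> sets borel"
    using B0(1) by (intro borel_closed compact_imp_closed)

  have L_AE: "AE t in \<mu>. t \<in> B0 \<longrightarrow> L (r + t) B = L t B" if B[measurable]: "B \<in> sets m" for B
  proof (rule dense_invariant_imp_AE_invariant[OF \<mu> H _ _ _ B0_sets B0(3)])
    \<comment> \<open>Measurability in \<open>t\<close> comes from Fubini, which needs a finite measure: \<open>m\<close> is replaced by
    \<open>|w| m\<close> and \<open>w\<close> by its phase.\<close>
    define N where "N = density m (\<lambda>x. ennreal (cmod (w x)))"
    have [measurable_cong, simp]: "sets N = sets m" by (simp add: N_def)
    have "emeasure N (space N) < \<infinity>"
      using w by (simp add: N_def emeasure_density integrable_iff_bounded cong: nn_integral_cong)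
    then interpret N: finite_measure N
      by (intro finite_measureI) auto
    have "I t B = (LINT x|N. indicator B (act t x) *\<^sub>R sgn (w x))" for t
    proof -
      have "(LINT x|N. indicator B (act t x) *\<^sub>R sgn (w x))
          = (LINT x|m. cmod (w x) *\<^sub>R (indicator B (act t x) *\<^sub>R sgn (w x)))"
        unfolding N_def by (rule integral_density) auto
      moreover have "cmod (w x) *\<^sub>R (indicator B (act t x) *\<^sub>R sgn (w x)) = indicator B (act t x) *\<^sub>R w x" for x
        by (cases "w x = 0") (simp_all add: sgn_div_norm)
      ultimately show ?thesis
        by (simp add: I_def)
    qed
    moreover have "(\<lambda>t. LINT x|N. indicator B (act t x) *\<^sub>R sgn (w x)) \<in> borel_measurable borel"
      by (intro N.borel_measurable_lebesgue_integral) measurable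
    ultimately have "(\<lambda>t. I t B) \<in> borel_measurable borel"
      by simp
    then show "(\<lambda>t. L t B) \<in> borel_measurable borel"
      unfolding L_def by measurable
  next
    fix t
    have "cmod (L t B) = cmod (I t B)"
      by (simp add: L_def norm_mult dual_group_norm[OF \<xi>])
    also have "\<dots> \<le> (LINT x|m. cmod (w x))"
      unfolding I_def by (intro norm_integral_le int B integrable_norm w) (auto simp: indicator_def)
    finally show "cmod (L t B) \<le> (LINT x|m. cmod (w x))" .
  next
    fix s t assume s: "s \<in> H"
    have "I (s + t) B = (LINT x|m. \<xi> s * (indicator B (act t (act s x)) *\<^sub>R w (act s x)))"
      unfolding I_def
    proof (rule integral_cong_AE)
      show "AE x in m. indicator B (act (s + t) x) *\<^sub>R w x
          = \<xi> s * (indicator B (act t (act s x)) *\<^sub>R w (act s x))"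
        using eq[OF s] AE_space
      proof eventually_elim
        case (elim x)
        then show ?case
          using act_add[OF sys elim(2), of t s] by (simp add: add.commute)
      qed
    qed measurable
    also have "\<dots> = \<xi> s * (LINT x|m. indicator B (act t (act s x)) *\<^sub>R w (act s x))"
      by (rule integral_mult_right_zero)
    also have "(LINT x|m. indicator B (act t (act s x)) *\<^sub>R w (act s x)) = I t B"
      unfolding I_def by (rule integral_act[OF sys, of "\<lambda>x. indicator B (act t x) *\<^sub>R w x"]) measurable
    finally have "L (s + t) B = (\<xi> s * cnj (\<xi> s)) * L t B"
      by (simp add: L_def dual_group_add[OF \<xi>] ac_simps)
    then show "L (s + t) B = L t B"
      by (simp add: dual_group_mult_cnj[OF \<xi>])
  qed

  have sections: "AE t in \<mu>. t \<in> B0 \<longrightarrow> (\<forall>u. L (r + t) (Pair u -` S) = L t (Pair u -` S))"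
    if S: "S \<in> sets (borel \<Otimes>\<^sub>M m)" for S :: "('g \<times> 'x) set"
    using Int_stable_pair_measure_generator pair_measure_closed S[unfolded sets_pair_measure]
  proof (induction rule: sigma_sets_induct_disjoint)
    case (basic S)
    then obtain A B where AB: "S = A \<times> B" "B \<in> sets m"
      by auto
    show ?case
      using L_AE[OF AB(2)]
    proof eventually_elim
      case (elim t)
      have "Pair u -` S = (if u \<in> A then B else {})" for u
        by (auto simp: AB)
      then show ?case
        using elim by (simp add: L_def I_def)
    qed
  next
    case empty
    show ?case by (simp add: L_def I_def)
  next
    case (compl S)
    then have S: "S \<in> sets (borel \<Otimes>\<^sub>M m)"
      by (simp add: sets_pair_measure)
    have *: "L t (Pair u -` (space borel \<times> space m - S)) = L t (space m) - L t (Pair u -` S)" for t u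
    proof -
      have [measurable]: "Pair u -` S \<in> sets m"
        using S by (rule sets_Pair1)
      have "I t (Pair u -` (space borel \<times> space m - S))
          = (LINT x|m. indicator (space m) (act t x) *\<^sub>R w x - indicator (Pair u -` S) (act t x) *\<^sub>R w x)"
        unfolding I_def by (intro Bochner_Integration.integral_cong) 
         (auto simp: indicator_def act_space[OF sys])
      also have "\<dots> = I t (space m) - I t (Pair u -` S)"
        unfolding I_def by (intro Bochner_Integration.integral_diff int) auto
      finally show ?thesis
        by (simp add: L_def right_diff_distrib)
    qed
    show ?case
      using compl.IH L_AE[OF sets.top]
    proof eventually_elim
      case (elim t)
      then show ?case unfolding * by simp
    qed
  next
    case (union S)
    then have S: "S i \<in> sets (borel \<Otimes>\<^sub>M m)" for i
      by (auto simp: sets_pair_measure)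
    have *: "L t (Pair u -` (\<Union>i. S i)) = (\<Sum>i. L t (Pair u -` S i))" for t u
    proof -
      have sec: "Pair u -` S i \<in> sets m" for i
        using S by (rule sets_Pair1)
      have vim: "act t -` (Pair u -` S i) \<inter> space m \<in> sets m" for i
        using measurable_sets[OF act_measurable[OF sys] sec] .
      have disj: "act t -` (Pair u -` S i) \<inter> space m \<inter> (act t -` (Pair u -` S j) \<inter> space m) = {}"
        if "i \<noteq> j" for i j
      proof -
        have "S i \<inter> S j = {}"
          using union.hyps(1) that by (simp add: disjoint_family_on_def)
        then show ?thesis by blast
      qed
      have set_form: "L t B = (LINT x:act t -` B \<inter> space m|m. cnj (\<xi> t) * w x)" for B
      proof -
        have "L t B = (LINT x|m. cnj (\<xi> t) * (indicator B (act t x) *\<^sub>R w x))"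
          unfolding L_def I_def by (rule integral_mult_right_zero[symmetric])
        also have "\<dots> = (LINT x:act t -` B \<inter> space m|m. cnj (\<xi> t) * w x)"
          unfolding set_lebesgue_integral_def
          by (intro Bochner_Integration.integral_cong) (auto simp: indicator_def)
        finally show ?thesis .
      qed
      have "L t (Pair u -` (\<Union>i. S i))
          = (LINT x:(\<Union>i. act t -` (Pair u -` S i) \<inter> space m)|m. cnj (\<xi> t) * w x)"
        by (simp add: set_form vimage_UN)
      also have "\<dots> = (\<Sum>i. L t (Pair u -` S i))"
        unfolding set_form
      proof (rule lebesgue_integral_countable_add[OF vim disj])
        show "set_integrable m (\<Union>i. act t -` (Pair u -` S i) \<inter> space m) (\<lambda>x. cnj (\<xi> t) * w x)"
          unfolding set_integrable_def
          by (intro integrable_mult_indicator sets.countable_UN integrable_mult_right w) (use vim in auto)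
      qed
      finally show ?thesis .
    qed
    have "AE t in \<mu>. \<forall>i. t \<in> B0 \<longrightarrow> (\<forall>u. L (r + t) (Pair u -` S i) = L t (Pair u -` S i))"
      by (rule AE_all_countable[THEN iffD2]) (intro allI union.IH)
    then show ?case
    proof eventually_elim
      case (elim t)
      then show ?case unfolding * by simp
    qed
  qed

  have "AE x in m. w x - \<xi> r * w (act r x) = 0"
  proof (rule AE_zero_if_set_integrals_zero)
    show "integrable m (\<lambda>x. w x - \<xi> r * w (act r x))"
      using w integrable_act[OF sys w] by auto
    fix B assume B[measurable]: "B \<in> sets m"
    define S where "S = {p \<in> space (borel \<Otimes>\<^sub>M m). act (fst p) (snd p) \<in> B}"
    have "S \<in> sets (borel \<Otimes>\<^sub>M m)"
      unfolding S_def by measurable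
    from sections[OF this] have AE_S: "AE t in \<mu>. t \<in> B0 \<longrightarrow> (\<forall>u. L (r + t) (Pair u -` S) = L t (Pair u -` S))" .
    have notnull: "\<not> (AE t in \<mu>. t \<notin> B0)"
      using B0(2) B0_sets by (subst AE_iff_null_sets[symmetric]) auto
    have "\<exists>t. \<forall>u. L (r + t) (Pair u -` S) = L t (Pair u -` S)"
    proof (rule ccontr)
      assume none: "\<not> ?thesis"
      have "AE t in \<mu>. t \<notin> B0"
        by (rule eventually_mono[OF AE_S]) (use none in blast)
      with notnull show False ..
    qed
    then obtain t where t: "L (r + t) (Pair u -` S) = L t (Pair u -` S)" for u
      by blast
    \<comment> \<open>With this section, \<open>L (r + t)\<close> integrates \<open>w\<close> over \<open>B\<close> and \<open>L t\<close> integrates \<open>w (act r \<cdot>)\<close> over \<open>B\<close>.\<close>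
    let ?u = "- (r + t)"
    have "I (r + t) (Pair ?u -` S) = (LINT x:B|m. w x)"
      unfolding I_def set_lebesgue_integral_def
    proof (intro Bochner_Integration.integral_cong refl)
      fix x assume x: "x \<in> space m"
      have "act ?u (act (r + t) x) = x"
        using act_add[OF sys x, of ?u "r + t"] act_zero[OF sys x] by simp
      then show "indicator (Pair ?u -` S) (act (r + t) x) *\<^sub>R w x = indicator B x *\<^sub>R w x"
        using act_space[OF sys x] by (simp add: S_def indicator_def space_pair_measure)
    qed
    moreover have "I t (Pair ?u -` S) = (LINT x|m. indicator B (act (- r) x) *\<^sub>R w x)"
      unfolding I_def
    proof (intro Bochner_Integration.integral_cong refl)
      fix x assume x: "x \<in> space m"
      have "act ?u (act t x) = act (- r) x"
        using act_add[OF sys x, of ?u t] by simp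
      then show "indicator (Pair ?u -` S) (act t x) *\<^sub>R w x = indicator B (act (- r) x) *\<^sub>R w x"
        using act_space[OF sys x] by (simp add: S_def indicator_def space_pair_measure)
    qed
    moreover have "(LINT x|m. indicator B (act (- r) x) *\<^sub>R w x) = (LINT x:B|m. w (act r x))"
    proof -
      have "(LINT x|m. indicator B (act (- r) x) *\<^sub>R w x)
          = (LINT x|m. indicator B (act (- r) (act r x)) *\<^sub>R w (act r x))"
        by (rule integral_act[OF sys, symmetric, of "\<lambda>x. indicator B (act (- r) x) *\<^sub>R w x"]) measurable
      also have "\<dots> = (LINT x:B|m. w (act r x))"
        unfolding set_lebesgue_integral_def
      proof (intro Bochner_Integration.integral_cong refl)
        fix x assume x: "x \<in> space m"
        show "indicator B (act (- r) (act r x)) *\<^sub>R w (act r x) = indicator B x *\<^sub>R w (act r x)"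
          using act_add[OF sys x, of "- r" r] act_zero[OF sys x] by simp
      qed
      finally show ?thesis .
    qed
    ultimately have "cnj (\<xi> (r + t)) * (LINT x:B|m. w x) = cnj (\<xi> t) * (LINT x:B|m. w (act r x))"
      using t[of ?u] by (simp add: L_def)
    then have "(\<xi> r * \<xi> t) * (cnj (\<xi> r * \<xi> t) * (LINT x:B|m. w x))
        = (\<xi> r * \<xi> t) * (cnj (\<xi> t) * (LINT x:B|m. w (act r x)))"
      by (simp add: dual_group_add[OF \<xi>])
    then have "(\<xi> r * cnj (\<xi> r)) * (\<xi> t * cnj (\<xi> t)) * (LINT x:B|m. w x)
        = (\<xi> t * cnj (\<xi> t)) * (\<xi> r * (LINT x:B|m. w (act r x)))"
      by (simp add: ac_simps)
    then have *: "(LINT x:B|m. w x) = \<xi> r * (LINT x:B|m. w (act r x))"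
      by (simp add: dual_group_mult_cnj[OF \<xi>])
    have "set_integrable m B w" "set_integrable m B (\<lambda>x. \<xi> r * w (act r x))"
      using w integrable_act[OF sys w] by (auto simp: set_integrable_def intro!: integrable_mult_indicator)
    then show "(LINT x:B|m. w x - \<xi> r * w (act r x)) = 0"
      using * by (simp add: set_integral_diff)
  qed
  then show ?thesis by eventually_elim simp
qed

text \<open>The preceding lemma needs an integrable function, whereas \<open>h\<close> is only square integrable; \<open>|h| cnj h\<close> is
integrable, is twisted by the conjugate character, and determines \<open>h\<close>.\<close>
lemma eigenfunction_equation_extends:
  fixes act :: "'g::{topological_ab_group_add, t2_space} \<Rightarrow> 'x \<Rightarrow> 'x"
  assumes \<mu>: "haar_measure (\<mu> :: 'g measure)" and sys: "measurable_dynamical_system act m"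
    and H: "dense_subgroup H" and \<xi>: "\<xi> \<in> dual_group"
    and h: "square_integrable m h"
    and eq: "\<And>s. s \<in> H \<Longrightarrow> AE x in m. h (act s x) = \<xi> s * h x"
  shows "AE x in m. h (act r x) = \<xi> r * h x"
proof -
  define w where "w x = cnj (h x) * cmod (h x)" for x
  have [measurable]: "h \<in> borel_measurable m"
    using h by (simp add: square_integrable_def)
  have [measurable]: "w \<in> borel_measurable m"
    unfolding w_def by measurable
  have "integrable m w"
    using square_integrable_norm_sq[OF h]
    by (rule Bochner_Integration.integrable_bound) (auto simp: w_def norm_mult power2_eq_square)
  moreover have "AE x in m. w x = \<xi> s * w (act s x)" if "s \<in> H" for s
    using eq[OF that]
  proof eventually_elim
    case (elim x)
    then have "\<xi> s * w (act s x) = (\<xi> s * cnj (\<xi> s)) * w x"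
      by (simp add: w_def norm_mult dual_group_norm[OF \<xi>])
    then show ?case
      by (simp add: dual_group_mult_cnj[OF \<xi>])
  qed
  ultimately have "AE x in m. w x = \<xi> r * w (act r x)"
    by (rule twisted_equivariance_extends[OF \<mu> sys H \<xi>])
  then show ?thesis
  proof eventually_elim
    case (elim x)
    then have "cmod (w x) = cmod (w (act r x))"
      by (simp add: norm_mult dual_group_norm[OF \<xi>])
    then have "(cmod (h x))\<^sup>2 = (cmod (h (act r x)))\<^sup>2"
      by (simp add: w_def norm_mult power2_eq_square)
    then have norm: "cmod (h (act r x)) = cmod (h x)"
      by (simp add: power2_eq_iff_nonneg)
    show ?case
    proof (cases "h x = 0")
      case True
      then show ?thesis using norm by simp
    next
      case False
      then have "cnj (h x) = \<xi> r * cnj (h (act r x))"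
        using elim norm by (simp add: w_def)
      then have "h x = cnj (\<xi> r) * h (act r x)"
        by (metis complex_cnj_cnj complex_cnj_mult)
      then have "\<xi> r * h x = (\<xi> r * cnj (\<xi> r)) * h (act r x)"
        by simp
      then show ?thesis
        by (simp add: dual_group_mult_cnj[OF \<xi>])
    qed
  qed
qed

section \<open>Representing a linear functional on a subspace\<close>
lemma inner_L2_diff_right:
  assumes "square_integrable m f" "square_integrable m g" "square_integrable m h"
  shows "inner_L2 m f (\<lambda>x. g x - h x) = inner_L2 m f g - inner_L2 m f h"
  using square_integrable_mult_cnj[OF assms(1,2)] square_integrable_mult_cnj[OF assms(1,3)]
  by (simp add: inner_L2_def right_diff_distrib)

lemma inner_L2_commute: "inner_L2 m f g = cnj (inner_L2 m g f)"
  using Bochner_Integration.integral_cnj[of m "\<lambda>x. g x * cnj (f x)"]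
  by (simp add: inner_L2_def mult.commute)

lemma inner_L2_tendsto:
  assumes f: "square_integrable m f" and g: "\<And>k. square_integrable m (g k)" and h: "square_integrable m h"
    and conv: "(\<lambda>k. norm_sq m (\<lambda>x. g k x - h x)) \<longlonglongrightarrow> 0"
  shows "(\<lambda>k. inner_L2 m f (g k)) \<longlonglongrightarrow> inner_L2 m f h"
proof (rule tendstoI)
  fix e :: real assume e: "0 < e"
  define d where "d = e / (norm_sq m f + 1)"
  have d: "0 < d" "d * norm_sq m f < e"
    using e norm_sq_nonneg[of m f] by (auto simp: d_def field_simps)
  have "eventually (\<lambda>k. norm_sq m (\<lambda>x. g k x - h x) < d * e) sequentially"
    using order_tendstoD(2)[OF conv, of "d * e"] d e by simp
  then show "eventually (\<lambda>k. dist (inner_L2 m f (g k)) (inner_L2 m f h) < e) sequentially"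
  proof eventually_elim
    case (elim k)
    then have "norm_sq m (\<lambda>x. g k x - h x) / d < e"
      using d by (simp add: field_simps)
    moreover have "2 * cmod (inner_L2 m f (\<lambda>x. g k x - h x))
        \<le> d * norm_sq m f + norm_sq m (\<lambda>x. g k x - h x) / d"
      by (intro norm_inner_L2_le f square_integrable_diff g h d)
    ultimately have "cmod (inner_L2 m f (\<lambda>x. g k x - h x)) < e"
      using d by linarith
    then show ?case
      by (simp add: inner_L2_diff_right[OF f g h] dist_norm)
  qed
qed

text \<open>The vector representing \<open>\<phi>\<close> maximises \<open>J g = 2 Re (\<phi> g) - \<parallel>g\<parallel>\<^sup>2\<close>, which for \<open>\<phi> = \<langle>\<cdot>, h\<rangle>\<close> equals
\<open>\<parallel>h\<parallel>\<^sup>2 - \<parallel>g - h\<parallel>\<^sup>2\<close>. The boundedness hypothesis bounds \<open>J\<close> from above, the parallelogram identity makes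
a maximising sequence Cauchy, and the first variation at its limit \<open>h\<close> vanishes. The sequence is part
of the conclusion since it witnesses that \<open>h\<close> lies in the closure of \<open>E\<close>.\<close>
lemma linear_functional_representation:
  assumes E: "complex_fun.subspace E" and sq: "\<And>g. g \<in> E \<Longrightarrow> square_integrable m g"
    and add: "\<And>f g. f \<in> E \<Longrightarrow> g \<in> E \<Longrightarrow> \<phi> (f + g) = \<phi> f + \<phi> g"
    and scale: "\<And>c g. g \<in> E \<Longrightarrow> \<phi> (fun_scale c g) = c * \<phi> g"
    and bound: "\<And>g. g \<in> E \<Longrightarrow> 2 * Re (\<phi> g) \<le> norm_sq m g + 1"
  obtains h g where "square_integrable m h" and "\<And>f. f \<in> E \<Longrightarrow> \<phi> f = inner_L2 m f h"
    and "\<And>k :: nat. g k \<in> E" and "(\<lambda>k. norm_sq m (\<lambda>x. g k x - h x)) \<longlonglongrightarrow> 0"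
proof -
  define J where "J g = 2 * Re (\<phi> g) - norm_sq m g" for g
  define j where "j = (SUP g\<in>E. J g)"
  have "J g \<le> 1" if "g \<in> E" for g
    using bound[OF that] by (simp add: J_def)
  then have bdd: "bdd_above (J ` E)"
    by (intro bdd_aboveI[of _ 1]) auto
  have ne: "E \<noteq> {}"
    using complex_fun.subspace_0[OF E] by auto
  have J_le: "J g \<le> j" if "g \<in> E" for g
    unfolding j_def using that bdd by (intro cSUP_upper)
  have comb: "f + fun_scale c g \<in> E" if "f \<in> E" "g \<in> E" for f g c
    using that E by (intro complex_fun.subspace_add complex_fun.subspace_scale)
  have J_comb: "J (f + fun_scale c g)
      = J f + 2 * Re (c * (\<phi> g - inner_L2 m g f)) - (cmod c)\<^sup>2 * norm_sq m g"
    if fg: "f \<in> E" "g \<in> E" for f g c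
  proof -
    have "f + fun_scale c g = (\<lambda>x. f x + c * g x)"
      by (simp add: fun_eq_iff fun_scale_def)
    then have "norm_sq m (f + fun_scale c g)
        = norm_sq m f + 2 * Re (c * inner_L2 m g f) + (cmod c)\<^sup>2 * norm_sq m g"
      using norm_sq_add_scale[OF sq sq] fg by simp
    moreover have "\<phi> (f + fun_scale c g) = \<phi> f + c * \<phi> g"
      using fg E by (simp add: add scale complex_fun.subspace_scale)
    ultimately show ?thesis
      by (simp add: J_def right_diff_distrib)
  qed
  have parallelogram: "norm_sq m (\<lambda>x. f x - g x) \<le> 2 * ((j - J f) + (j - J g))"
    if fg: "f \<in> E" "g \<in> E" for f g
  proof -
    have le: "J (fun_scale (1/2) (f + fun_scale 1 g)) \<le> j"
      using fg E by (intro J_le complex_fun.subspace_scale comb)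
    have mid: "J (fun_scale (1/2) (f + fun_scale 1 g))
        = Re (\<phi> f) + Re (\<phi> g) - (norm_sq m f + 2 * Re (inner_L2 m g f) + norm_sq m g) / 4"
    proof -
      have "norm_sq m (fun_scale (1/2) (f + fun_scale 1 g))
          = (1/4) * norm_sq m (\<lambda>x. f x + 1 * g x)"
        using norm_sq_scale[of m "1/2" "\<lambda>x. f x + 1 * g x"]
        by (simp add: fun_scale_def plus_fun_def power2_eq_square)
      moreover have "\<phi> (fun_scale (1/2) (f + fun_scale 1 g)) = (1/2) * (\<phi> f + 1 * \<phi> g)"
        using fg E comb[OF fg, of 1] by (simp only: add scale complex_fun.subspace_scale)
      then have "2 * Re (\<phi> (fun_scale (1/2) (f + fun_scale 1 g))) = Re (\<phi> f) + Re (\<phi> g)"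
        by (simp only: Re_divide_numeral mult_1 times_divide_eq_left plus_complex.sel) simp
      ultimately show ?thesis
        using norm_sq_add_scale[OF sq[OF fg(1)] sq[OF fg(2)], of 1] by (simp add: J_def)
    qed
    have "norm_sq m (\<lambda>x. f x - g x) = norm_sq m f - 2 * Re (inner_L2 m g f) + norm_sq m g"
      using norm_sq_add_scale[OF sq[OF fg(1)] sq[OF fg(2)], of "-1"] by simp
    with le[unfolded mid] show ?thesis
      unfolding J_def by argo
  qed
  have "\<exists>g\<in>E. j - (1/4) ^ k / 4 < J g" for k :: nat
    using less_cSUP_iff[OF ne bdd, of "j - (1/4) ^ k / 4"] by (simp add: j_def)
  then obtain g where g: "\<And>k. g k \<in> E" and Jg: "\<And>k. j - (1/4) ^ k / 4 < J (g k)"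
    by metis
  have fast: "norm_sq m (\<lambda>x. g k x - g l x) \<le> (1/4) ^ k" if "k \<le> l" for k l
  proof -
    have "(1/4::real) ^ l \<le> (1/4) ^ k"
      using that by (intro power_decreasing) auto
    then show ?thesis
      using parallelogram[OF g[of k] g[of l]] Jg[of k] Jg[of l] by argo
  qed
  obtain h where h: "square_integrable m h" and gh: "\<And>k. norm_sq m (\<lambda>x. g k x - h x) \<le> (1/4) ^ k"
    using L2_complete_fast[of m g] sq g fast by blast
  have conv: "(\<lambda>k. norm_sq m (\<lambda>x. g k x - h x)) \<longlonglongrightarrow> 0"
  proof (rule tendsto_sandwich[of "\<lambda>_. 0" _ _ "\<lambda>k. (1/4) ^ k"])
    show "(\<lambda>k. (1/4::real) ^ k) \<longlonglongrightarrow> 0"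
      by (rule LIMSEQ_power_zero) simp
  qed (auto simp: norm_sq_nonneg gh)
  have "\<phi> f = inner_L2 m f h" if f: "f \<in> E" for f
  proof (rule ccontr)
    assume "\<phi> f \<noteq> inner_L2 m f h"
    define v where "v = \<phi> f - inner_L2 m f h"
    have v: "v \<noteq> 0" using \<open>\<phi> f \<noteq> inner_L2 m f h\<close> by (simp add: v_def)
    have variation: "2 * Re (c * v) \<le> (cmod c)\<^sup>2 * norm_sq m f" for c
    proof -
      have "2 * Re (c * (\<phi> f - inner_L2 m f (g k))) \<le> (cmod c)\<^sup>2 * norm_sq m f + (1/4) ^ k / 4" for k
        using J_le[OF comb[OF g f], of k c] J_comb[OF g f, of k c] Jg[of k] by argo
      moreover have "(\<lambda>k. 2 * Re (c * (\<phi> f - inner_L2 m f (g k)))) \<longlonglongrightarrow> 2 * Re (c * v)"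
        unfolding v_def by (intro tendsto_intros inner_L2_tendsto conv h sq g f)
      moreover have "(\<lambda>k. (cmod c)\<^sup>2 * norm_sq m f + (1/4) ^ k / 4) \<longlonglongrightarrow> (cmod c)\<^sup>2 * norm_sq m f + 0 / 4"
        by (intro tendsto_intros LIMSEQ_power_zero) auto
      ultimately show ?thesis
        using LIMSEQ_le[of _ "2 * Re (c * v)" _ "(cmod c)\<^sup>2 * norm_sq m f"] by auto
    qed
    \<comment> \<open>Varying in the direction \<open>t * cnj v\<close>, the linear gain \<open>2 * t * |v|\<^sup>2\<close> beats the quadratic loss for
    this small \<open>t\<close>.\<close>
    define t where "t = 1 / (norm_sq m f + 1)"
    have t: "0 < t" "t * norm_sq m f < 1"
      using norm_sq_nonneg[of m f] by (auto simp: t_def field_simps)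
    have "2 * (t * (cmod v)\<^sup>2) \<le> t * (cmod v)\<^sup>2 * (t * norm_sq m f)"
    proof -
      have "(complex_of_real t * cnj v) * v = complex_of_real (t * (cmod v)\<^sup>2)"
        using complex_norm_square[of v] by (simp add: mult.commute mult.left_commute)
      then have Re_eq: "Re ((complex_of_real t * cnj v) * v) = t * (cmod v)\<^sup>2"
        by (metis Re_complex_of_real)
      have norm_eq: "(cmod (complex_of_real t * cnj v))\<^sup>2 = t * (cmod v)\<^sup>2 * t"
        by (simp add: norm_mult power_mult_distrib power2_eq_square)
      show ?thesis
        using variation[of "complex_of_real t * cnj v"] unfolding Re_eq norm_eq
        by (simp only: mult.assoc)
    qed
    also have "\<dots> \<le> t * (cmod v)\<^sup>2 * 1"
      using t by (intro mult_left_mono) auto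
    finally have "t * (cmod v)\<^sup>2 \<le> 0"
      by simp
    moreover have "0 < t * (cmod v)\<^sup>2"
      using t v by simp
    ultimately show False by simp
  qed
  then show ?thesis
    using that h g conv by blast
qed

text \<open>On the approximating sequence equivariance of \<open>\<phi>\<close> reads \<open>\<langle>T g\<^sub>k, h\<rangle> = c \<langle>g\<^sub>k, h\<rangle>\<close>, where \<open>T\<close> is translation by
\<open>s\<close>. In the limit \<open>\<langle>T h, h\<rangle> = c \<parallel>h\<parallel>\<^sup>2\<close>; since \<open>T\<close> is isometric this is the equality case of Cauchy-Schwarz,
and \<open>\<parallel>T h - c h\<parallel>\<^sup>2\<close> expands to zero.\<close>
lemma representative_equivariant:
  fixes m :: "'x measure"
  assumes sys: "measurable_dynamical_system act m"
    and sq: "\<And>g. g \<in> E \<Longrightarrow> square_integrable m g"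
    and inv: "\<And>g. g \<in> E \<Longrightarrow> translate act m s g \<in> E"
    and h: "square_integrable m h" and rep: "\<And>f. f \<in> E \<Longrightarrow> \<phi> f = inner_L2 m f h"
    and g: "\<And>k :: nat. g k \<in> E" "(\<lambda>k. norm_sq m (\<lambda>x. g k x - h x)) \<longlonglongrightarrow> 0"
    and equiv: "\<And>f. f \<in> E \<Longrightarrow> \<phi> (translate act m s f) = c * \<phi> f" and c: "cmod c = 1"
  shows "AE x in m. h (act s x) = c * h x"
proof -
  let ?T = "\<lambda>f x. f (act s x)"
  have sqT: "square_integrable m (?T f)" if "square_integrable m f" for f :: "'x \<Rightarrow> complex"
    using that integrable_act[OF sys, of "\<lambda>x. (cmod (f x))\<^sup>2" s]
      measurable_compose[OF act_measurable[OF sys, of s], of f borel]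
    by (simp add: square_integrable_def)
  have normT: "norm_sq m (?T f) = norm_sq m f" if "square_integrable m f" for f :: "'x \<Rightarrow> complex"
    using integral_act[OF sys borel_measurable_integrable[OF square_integrable_norm_sq[OF that]]]
    by (simp add: norm_sq_def)
  have "(\<lambda>k. inner_L2 m h (?T (g k))) \<longlonglongrightarrow> inner_L2 m h (?T h)"
  proof (rule inner_L2_tendsto)
    show "(\<lambda>k. norm_sq m (\<lambda>x. g k (act s x) - h (act s x))) \<longlonglongrightarrow> 0"
      using g normT[OF square_integrable_diff[OF sq h]] by simp
  qed (use h sqT sq g in auto)
  moreover have "inner_L2 m h (?T (g k)) = cnj c * inner_L2 m h (g k)" for k
  proof -
    have "inner_L2 m (translate act m s (g k)) h = c * inner_L2 m (g k) h"
      using rep[OF inv] rep equiv g(1) by simp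
    moreover have "inner_L2 m (translate act m s (g k)) h = inner_L2 m (?T (g k)) h"
      unfolding inner_L2_def by (intro Bochner_Integration.integral_cong) (auto simp: translate_def)
    ultimately have "inner_L2 m (?T (g k)) h = c * inner_L2 m (g k) h"
      by simp
    then show ?thesis
      unfolding inner_L2_commute[of m h] by simp
  qed
  moreover have "(\<lambda>k. cnj c * inner_L2 m h (g k)) \<longlonglongrightarrow> cnj c * inner_L2 m h h"
    by (intro tendsto_intros inner_L2_tendsto h sq g)
  ultimately have "inner_L2 m h (?T h) = cnj c * inner_L2 m h h"
    using LIMSEQ_unique by simp
  then have "c * inner_L2 m h (?T h) = norm_sq m h"
    using c by (simp add: inner_L2_self complex_norm_square[symmetric] flip: mult.assoc)
  then have "norm_sq m (\<lambda>x. h (act s x) + (- c) * h x) = 0"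
    using norm_sq_add_scale[OF sqT[OF h] h, of "- c"] c normT[OF h] by simp
  then have "AE x in m. h (act s x) + (- c) * h x = 0"
    using norm_sq_eq_0_iff square_integrable_add[OF sqT[OF h] square_integrable_scale[OF h]] by blast
  then show ?thesis by eventually_elim simp
qed

section \<open>Compactness and cluster points\<close>
text \<open>Singletons are compact, so the compact-open topology refines the topology of pointwise convergence, which
is the one carried by the function type.\<close>
lemma compactin_dual_topology_imp_compact:
  fixes K :: "('g::topological_ab_group_add \<Rightarrow> complex) set"
  assumes "compactin dual_topology K"
  shows "compact K" and "K \<subseteq> dual_group"
proof -
  have basis: "openin dual_topology {\<xi> \<in> dual_group. \<xi> ` C \<subseteq> U}"
    if "compact C" "open U" for C :: "'g set" and U
    unfolding dual_topology_def using that by (intro topology_generated_by_Basis) blast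
  have top: "topspace dual_topology = (dual_group :: ('g \<Rightarrow> complex) set)"
  proof
    show "topspace dual_topology \<subseteq> (dual_group :: ('g \<Rightarrow> complex) set)"
      unfolding dual_topology_def topology_generated_by_topspace by blast
    show "(dual_group :: ('g \<Rightarrow> complex) set) \<subseteq> topspace dual_topology"
      using openin_subset[OF basis[of "{}" UNIV]] by simp
  qed
  show "K \<subseteq> dual_group"
    using compactin_subset_topspace[OF assms] by (simp add: top)
  have "continuous_map dual_topology euclidean (\<lambda>\<xi> :: 'g \<Rightarrow> complex. \<xi> t)" for t
    unfolding continuous_map_def top
  proof (intro conjI allI impI)
    fix U :: "complex set" assume "openin euclidean U"
    then show "openin dual_topology {\<xi> \<in> dual_group. \<xi> t \<in> U}"
      using basis[of "{t}" U] by simp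
  qed auto
  then have "continuous_map dual_topology euclidean (\<lambda>\<xi> :: 'g \<Rightarrow> complex. \<xi>)"
    by (simp add: continuous_map_componentwise_UNIV flip: euclidean_product_topology)
  from image_compactin[OF assms this] show "compact K"
    by simp
qed

text \<open>The substitute for convergent subsequences in a compact space that need not be metrizable.\<close>
lemma compact_cluster_filter:
  fixes y :: "'n \<Rightarrow> 'a::topological_space"
  assumes "compact S" "\<And>n. y n \<in> S" "F \<noteq> bot"
  obtains p F' where "p \<in> S" "F' \<noteq> bot" "F' \<le> F" "(y \<longlongrightarrow> p) F'"
proof -
  have "filtermap y F \<noteq> bot" "eventually (\<lambda>x. x \<in> S) (filtermap y F)"
    using assms by (auto simp: filtermap_bot_iff eventually_filtermap)
  then obtain p where p: "p \<in> S" "inf (nhds p) (filtermap y F) \<noteq> bot"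
    using assms(1) unfolding compact_filter by blast
  define F' where "F' = inf F (filtercomap y (nhds p))"
  have "F' \<noteq> bot"
  proof
    assume "F' = bot"
    then have "eventually (\<lambda>_. False) F'" by simp
    then obtain P Q where PQ: "eventually P F" "eventually Q (filtercomap y (nhds p))"
      "\<And>n. P n \<Longrightarrow> Q n \<Longrightarrow> False"
      unfolding F'_def eventually_inf by blast
    then obtain R where R: "eventually R (nhds p)" "\<And>n. R (y n) \<Longrightarrow> Q n"
      unfolding eventually_filtercomap by blast
    have "eventually (\<lambda>x. \<not> R x) (filtermap y F)"
      unfolding eventually_filtermap using PQ(1) by eventually_elim (use PQ(3) R(2) in blast)
    with R(1) have "eventually (\<lambda>_. False) (inf (nhds p) (filtermap y F))"
      unfolding eventually_inf by blast
    with p(2) show False by (simp add: eventually_False)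
  qed
  moreover have "(y \<longlongrightarrow> p) F'"
    unfolding filterlim_def F'_def
    by (rule order_trans[OF filtermap_mono[OF inf_le2] filtermap_filtercomap])
  moreover have "F' \<le> F"
    by (simp add: F'_def)
  ultimately show ?thesis
    using that p(1) by blast
qed

lemma compact_bounded_functions:
  "compact {\<phi> :: 'a \<Rightarrow> complex. \<forall>g. cmod (\<phi> g) \<le> b g}"
proof -
  have "compactin (product_topology (\<lambda>_. euclidean) UNIV) (PiE UNIV (\<lambda>g. cball (0::complex) (b g)))"
    unfolding compactin_PiE by simp
  moreover have "PiE UNIV (\<lambda>g. cball (0::complex) (b g)) = {\<phi>. \<forall>g. cmod (\<phi> g) \<le> b g}"
    by (auto simp: PiE_UNIV_domain)
  ultimately show ?thesis
    by (simp add: euclidean_product_topology)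
qed

lemma fun_tendsto_pointwise:
  fixes f :: "'n \<Rightarrow> 'a \<Rightarrow> 'b::topological_space"
  assumes "(f \<longlongrightarrow> l) F"
  shows "((\<lambda>n. f n x) \<longlongrightarrow> l x) F"
  using continuous_on_tendsto_compose[OF continuous_on_product_coordinates[of x] assms] by simp

section \<open>Averages along the orbit of a generic point\<close>
definition twisted_average ::
    "'g measure \<Rightarrow> ('g \<Rightarrow> 'x \<Rightarrow> 'x) \<Rightarrow> 'x \<Rightarrow> 'g set \<Rightarrow> ('g \<Rightarrow> complex) \<Rightarrow> ('x \<Rightarrow> complex) \<Rightarrow> complex" where
  "twisted_average \<mu> act x A \<xi> g
     = (LINT t:A|\<mu>. g (act t x) * cnj (\<xi> t)) / complex_of_real (measure \<mu> A)"

lemma L2_Linf_bounded: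
  assumes "g \<in> L2_Linf m"
  obtains c where "\<And>y. cmod (g y) \<le> c"
proof -
  obtain c where "\<forall>y\<in>space m. cmod (g y) \<le> c"
    using assms by (auto simp: L2_Linf_def bounded_iff)
  then have "cmod (g y) \<le> max c 0" for y
    using assms by (cases "y \<in> space m") (auto simp: L2_Linf_def functions_on_def le_max_iff_disj)
  then show ?thesis using that by blast
qed

lemma haar_emeasure_relatively_compact:
  assumes "haar_measure \<mu>" "open A" "compact (closure A)"
  shows "emeasure \<mu> A < \<infinity>"
proof -
  have "emeasure \<mu> A \<le> emeasure \<mu> (closure A)"
    using assms(3) by (intro emeasure_mono closure_subset)
       (auto simp: haar_sets[OF assms(1)] intro: borel_closed)
  also have "\<dots> < \<infinity>"
    using assms(1,3) unfolding haar_measure_def by blast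
  finally show ?thesis .
qed

locale orbit_averages =
  fixes \<mu> :: "'g::{topological_ab_group_add, t2_space} measure"
    and act :: "'g \<Rightarrow> 'x \<Rightarrow> 'x" and m :: "'x measure" and A :: "nat \<Rightarrow> 'g set" and x :: 'x
  assumes \<mu>: "haar_measure \<mu>"
    and sys: "measurable_dynamical_system act m"
    and folner: "Folner_sequence \<mu> A"
    and x: "x \<in> space m"
begin

lemma sets_haar [measurable_cong, simp]: "sets \<mu> = sets borel"
  using \<mu> by (rule haar_sets)

lemma A_sets [measurable, simp]: "A n \<in> sets borel"
  using folner by (auto simp: Folner_sequence_def)

lemma A_finite: "emeasure \<mu> (A n) < \<infinity>"
  using folner by (intro haar_emeasure_relatively_compact[OF \<mu>]) (auto simp: Folner_sequence_def)

lemma A_pos: "0 < measure \<mu> (A n)"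
  using folner by (simp add: Folner_sequence_def)

lemma orbit_product_measurable:
  assumes "g \<in> L2_Linf m" "\<xi> \<in> dual_group"
  shows "(\<lambda>t. g (act t x) * cnj (\<xi> t)) \<in> borel_measurable borel"
proof -
  have [measurable]: "g \<in> borel_measurable m" "\<xi> \<in> borel_measurable borel"
      "(\<lambda>t. act t x) \<in> borel \<rightarrow>\<^sub>M m"
    using assms dual_group_measurable orbit_measurable[OF sys x]
    by (auto simp: L2_Linf_def square_integrable_def)
  show ?thesis by measurable
qed

lemma orbit_product_bound:
  assumes "\<And>y. cmod (g y) \<le> c" "\<xi> \<in> dual_group"
  shows "cmod (g (act t x) * cnj (\<xi> t)) \<le> c"
  using assms by (simp add: norm_mult dual_group_norm)

lemma orbit_product_integrable:
  assumes "g \<in> L2_Linf m" "\<xi> \<in> dual_group"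
  shows "set_integrable \<mu> (A n) (\<lambda>t. g (act t x) * cnj (\<xi> t))"
proof -
  obtain c where "\<And>y. cmod (g y) \<le> c"
    using L2_Linf_bounded[OF assms(1)] by blast
  then show ?thesis
    using orbit_product_measurable[OF assms] orbit_product_bound[OF _ assms(2)] A_finite
    by (intro set_integrable_bounded[where c = c]) auto
qed

lemma twisted_average_bound:
  assumes "g \<in> L2_Linf m" "\<xi> \<in> dual_group" "\<And>y. cmod (g y) \<le> c"
  shows "cmod (twisted_average \<mu> act x (A n) \<xi> g) \<le> c"
proof -
  have "cmod ((LINT t:A n|\<mu>. g (act t x) * cnj (\<xi> t)) - (LINT t:{}|\<mu>. g (act t x) * cnj (\<xi> t)))
      \<le> c * measure \<mu> (sym_diff (A n) {})"
    using orbit_product_measurable[OF assms(1,2)] orbit_product_bound[OF assms(3,2)] A_finite[of n]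
    by (intro cmod_set_integral_diff_le) auto
  then have "cmod (LINT t:A n|\<mu>. g (act t x) * cnj (\<xi> t)) \<le> c * measure \<mu> (A n)"
    by (simp add: set_lebesgue_integral_def)
  then show ?thesis
    using A_pos[of n] by (simp add: twisted_average_def norm_divide field_simps)
qed

lemma twisted_average_add:
  assumes "f \<in> L2_Linf m" "g \<in> L2_Linf m" "\<xi> \<in> dual_group"
  shows "twisted_average \<mu> act x (A n) \<xi> (f + g)
       = twisted_average \<mu> act x (A n) \<xi> f + twisted_average \<mu> act x (A n) \<xi> g"
  using set_integral_add(2)[OF orbit_product_integrable[OF assms(1,3)] orbit_product_integrable[OF assms(2,3)]]
  by (simp add: twisted_average_def distrib_right add_divide_distrib)

lemma twisted_average_scale:
  "twisted_average \<mu> act x (A n) \<xi> (fun_scale c g) = c * twisted_average \<mu> act x (A n) \<xi> g"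
  by (simp add: twisted_average_def fun_scale_def mult.assoc)

text \<open>Integrating \<open>2 Re (g cnj \<xi>) \<le> |g|\<^sup>2 + 1\<close> over \<open>A n\<close>. By genericity the right-hand side tends to \<open>\<parallel>g\<parallel>\<^sup>2 + 1\<close>, which
is the form of boundedness asked for in \<open>linear_functional_representation\<close>.\<close>
lemma twisted_average_Re_le:
  assumes g: "g \<in> L2_Linf m" and \<xi>: "\<xi> \<in> dual_group"
  shows "2 * Re (twisted_average \<mu> act x (A n) \<xi> g)
     \<le> Re ((LINT t:A n|\<mu>. g (act t x) * cnj (g (act t x))) / complex_of_real (measure \<mu> (A n))) + 1"
proof -
  let ?p = "\<lambda>t. g (act t x) * cnj (\<xi> t)" and ?q = "\<lambda>t. g (act t x) * cnj (g (act t x))"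
  obtain c where c: "\<And>y. cmod (g y) \<le> c"
    using L2_Linf_bounded[OF g] by blast
  have c0: "0 \<le> c" using c norm_ge_zero order_trans by blast
  have [measurable]: "g \<in> borel_measurable m" "(\<lambda>t. act t x) \<in> borel \<rightarrow>\<^sub>M m"
    using g orbit_measurable[OF sys x] by (auto simp: L2_Linf_def square_integrable_def)
  have p: "set_integrable \<mu> (A n) ?p"
    by (rule orbit_product_integrable[OF g \<xi>])
  have q: "set_integrable \<mu> (A n) ?q"
    using c c0 A_finite
    by (intro set_integrable_bounded[where c = "c * c"]) (auto simp: norm_mult intro!: mult_mono)
  have one: "set_integrable \<mu> (A n) (\<lambda>_. 1 :: real)"
    using A_finite[of n] by (simp add: set_integrable_def)
  have Re: "Re (LINT t:A n|\<mu>. f t) = (LINT t:A n|\<mu>. Re (f t))" "set_integrable \<mu> (A n) (\<lambda>t. Re (f t))"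
    if "set_integrable \<mu> (A n) f" for f :: "'g \<Rightarrow> complex"
    using integral_Re[OF that[unfolded set_integrable_def]] integrable_Re[OF that[unfolded set_integrable_def]]
    by (simp_all add: set_lebesgue_integral_def set_integrable_def)
  have "2 * Re (LINT t:A n|\<mu>. ?p t) = (LINT t:A n|\<mu>. 2 * Re (?p t))"
    unfolding Re(1)[OF p] by (rule set_integral_mult_right[symmetric])
  also have "\<dots> \<le> (LINT t:A n|\<mu>. Re (?q t) + 1)"
  proof (rule set_integral_mono)
    fix t
    have "2 * Re (?p t) \<le> 2 * cmod (?p t)"
      using complex_Re_le_cmod[of "?p t"] by linarith
    also have "\<dots> = 2 * cmod (g (act t x)) * 1"
      by (simp add: norm_mult dual_group_norm[OF \<xi>])
    also have "\<dots> \<le> (cmod (g (act t x)))\<^sup>2 + 1\<^sup>2"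
      by (rule sum_squares_bound)
    also have "\<dots> = Re (?q t) + 1"
      unfolding complex_norm_square[symmetric] Re_complex_of_real by simp
    finally show "2 * Re (?p t) \<le> Re (?q t) + 1" .
    show "set_integrable \<mu> (A n) (\<lambda>t. 2 * Re (?p t))"
      by (intro set_integrable_mult_right Re(2) p)
    show "set_integrable \<mu> (A n) (\<lambda>t. Re (?q t) + 1)"
      by (intro set_integral_add(1) Re(2) q one)
  qed
  also have "\<dots> = Re (LINT t:A n|\<mu>. ?q t) + measure \<mu> (A n)"
    using set_integral_add(2)[OF Re(2)[OF q] one] Re(1)[OF q]
    by (simp add: set_lebesgue_integral_def)
  finally show ?thesis
    using A_pos[of n] by (simp add: twisted_average_def field_simps)
qed

text \<open>Translating \<open>g\<close> by \<open>s\<close> amounts, up to the factor \<open>\<xi> s\<close>, to averaging over \<open>s + A n\<close> instead of \<open>A n\<close>.\<close>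
lemma twisted_average_translate:
  assumes g: "g \<in> L2_Linf m" and \<xi>: "\<xi> \<in> dual_group" and c: "\<And>y. cmod (g y) \<le> c"
  shows "cmod (twisted_average \<mu> act x (A n) \<xi> (translate act m s g)
                 - \<xi> s * twisted_average \<mu> act x (A n) \<xi> g)
       \<le> c * (measure \<mu> (sym_diff (A n) ((+) s ` A n)) / measure \<mu> (A n))"
proof -
  let ?p = "\<lambda>t. g (act t x) * cnj (\<xi> t)"
  have p: "?p \<in> borel_measurable borel"
    by (rule orbit_product_measurable[OF g \<xi>])
  have "(LINT t:A n|\<mu>. translate act m s g (act t x) * cnj (\<xi> t)) = (LINT t:A n|\<mu>. \<xi> s * ?p (s + t))"
  proof (rule set_lebesgue_integral_cong)
    show "\<forall>t. t \<in> A n \<longrightarrow> translate act m s g (act t x) * cnj (\<xi> t) = \<xi> s * ?p (s + t)"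
    proof (intro allI impI)
      fix t
      have "\<xi> s * ?p (s + t) = (\<xi> s * cnj (\<xi> s)) * (g (act s (act t x)) * cnj (\<xi> t))"
        by (simp add: dual_group_add[OF \<xi>] act_add[OF sys x] ac_simps)
      then show "translate act m s g (act t x) * cnj (\<xi> t) = \<xi> s * ?p (s + t)"
        by (simp add: dual_group_mult_cnj[OF \<xi>] translate_def act_space[OF sys x])
    qed
  qed simp
  also have "\<dots> = \<xi> s * (LINT t:A n|\<mu>. ?p (s + t))"
    by simp
  also have "(LINT t:A n|\<mu>. ?p (s + t)) = (LINT t:(+) s ` A n|\<mu>. ?p t)"
    by (rule haar_set_integral_translate[OF \<mu> p A_sets])
  finally have "twisted_average \<mu> act x (A n) \<xi> (translate act m s g)
        - \<xi> s * twisted_average \<mu> act x (A n) \<xi> g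
      = \<xi> s * ((LINT t:(+) s ` A n|\<mu>. ?p t) - (LINT t:A n|\<mu>. ?p t)) / complex_of_real (measure \<mu> (A n))"
    by (simp add: twisted_average_def right_diff_distrib diff_divide_distrib)
  then have "cmod (twisted_average \<mu> act x (A n) \<xi> (translate act m s g)
        - \<xi> s * twisted_average \<mu> act x (A n) \<xi> g)
      = cmod ((LINT t:A n|\<mu>. ?p t) - (LINT t:(+) s ` A n|\<mu>. ?p t)) / measure \<mu> (A n)"
    using A_pos[of n] by (simp add: norm_divide norm_mult dual_group_norm[OF \<xi>] norm_minus_commute)
  also have "\<dots> \<le> (c * measure \<mu> (sym_diff (A n) ((+) s ` A n))) / measure \<mu> (A n)"
    using p orbit_product_bound[OF c \<xi>] A_finite[of n] A_pos[of n]
      haar_emeasure_translate[OF \<mu> A_sets[of n], of s] translate_sets_borel[OF A_sets[of n], of s]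
    by (intro divide_right_mono cmod_set_integral_diff_le) auto
  finally show ?thesis by simp
qed

text \<open>The limits are taken along an arbitrary filter of large indices, because the cluster points found by compactness
come without a subsequence.\<close>
lemma limit_functional_vanishes:
  assumes E: "complex_fun.subspace E" "E \<subseteq> L2_Linf m" "invariant_under act m H E"
    and H: "dense_subgroup H" and gen: "generic \<mu> act m A E H x"
    and \<psi>: "\<And>n. \<psi> n \<in> dual_group" and \<xi>: "\<xi> \<in> dual_group"
    and perp: "\<And>h. eigenfunction act m \<xi> h \<Longrightarrow> inner_L2 m f h = 0"
    and F: "F \<noteq> bot" "F \<le> sequentially"
    and lim_\<psi>: "\<And>t. ((\<lambda>n. \<psi> n t) \<longlongrightarrow> \<xi> t) F"
    and lim: "\<And>g. g \<in> E \<Longrightarrow> ((\<lambda>n. twisted_average \<mu> act x (A n) (\<psi> n) g) \<longlongrightarrow> \<phi> g) F"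
    and f: "f \<in> E"
  shows "\<phi> f = 0"
proof -
  let ?av = "\<lambda>n g. twisted_average \<mu> act x (A n) (\<psi> n) g"
  have EL: "g \<in> L2_Linf m" if "g \<in> E" for g
    using that E by blast
  have sq: "square_integrable m g" if "g \<in> E" for g
    using EL[OF that] by (simp add: L2_Linf_def)
  have inv: "translate act m s g \<in> E" if "g \<in> E" "s \<in> H" for g s
    using that E(3) by (simp add: invariant_under_def)
  have add: "\<phi> (g + h) = \<phi> g + \<phi> h" if "g \<in> E" "h \<in> E" for g h
  proof (rule tendsto_unique[OF F(1)])
    show "((\<lambda>n. ?av n (g + h)) \<longlongrightarrow> \<phi> (g + h)) F"
      using that E by (intro lim complex_fun.subspace_add)
    show "((\<lambda>n. ?av n (g + h)) \<longlongrightarrow> \<phi> g + \<phi> h) F"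
      unfolding twisted_average_add[OF EL[OF that(1)] EL[OF that(2)] \<psi>] by (intro tendsto_add lim that)
  qed
  have scale: "\<phi> (fun_scale c g) = c * \<phi> g" if "g \<in> E" for g c
  proof (rule tendsto_unique[OF F(1)])
    show "((\<lambda>n. ?av n (fun_scale c g)) \<longlongrightarrow> \<phi> (fun_scale c g)) F"
      using that E by (intro lim complex_fun.subspace_scale)
    show "((\<lambda>n. ?av n (fun_scale c g)) \<longlongrightarrow> c * \<phi> g) F"
      unfolding twisted_average_scale by (intro tendsto_mult_left lim that)
  qed
  have bound: "2 * Re (\<phi> g) \<le> norm_sq m g + 1" if g: "g \<in> E" for g
  proof (rule tendsto_le[OF F(1)])
    let ?c = "\<lambda>n. (LINT t:A n|\<mu>. g (act t x) * cnj (g (act t x))) / complex_of_real (measure \<mu> (A n))"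
    have "(?c \<longlongrightarrow> inner_L2 m g g) F"
    proof (rule tendsto_mono[OF F(2)])
      show "?c \<longlonglongrightarrow> inner_L2 m g g"
        using gen g by (simp add: generic_def)
    qed
    from tendsto_add[OF tendsto_Re[OF this] tendsto_const[of 1]]
    show "((\<lambda>n. Re (?c n) + 1) \<longlongrightarrow> norm_sq m g + 1) F"
      unfolding inner_L2_self Re_complex_of_real .
    show "((\<lambda>n. 2 * Re (?av n g)) \<longlongrightarrow> 2 * Re (\<phi> g)) F"
      by (intro tendsto_intros lim g)
    show "eventually (\<lambda>n. 2 * Re (?av n g) \<le> Re (?c n) + 1) F"
      by (rule always_eventually, rule allI, rule twisted_average_Re_le[OF EL[OF g] \<psi>])
  qed
  have equiv: "\<phi> (translate act m s g) = \<xi> s * \<phi> g" if g: "g \<in> E" and s: "s \<in> H" for g s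
  proof -
    obtain c where c: "\<And>y. cmod (g y) \<le> c"
      using L2_Linf_bounded[OF EL[OF g]] by blast
    have "((\<lambda>n. c * (measure \<mu> (sym_diff (A n) ((+) s ` A n)) / measure \<mu> (A n))) \<longlongrightarrow> c * 0) F"
    proof (intro tendsto_mult_left tendsto_mono[OF F(2)])
      show "(\<lambda>n. measure \<mu> (sym_diff (A n) ((+) s ` A n)) / measure \<mu> (A n)) \<longlonglongrightarrow> 0"
        using folner unfolding Folner_sequence_def by blast
    qed
    then have error: "((\<lambda>n. c * (measure \<mu> (sym_diff (A n) ((+) s ` A n)) / measure \<mu> (A n))) \<longlongrightarrow> 0) F"
      by (simp only: mult_zero_right)
    have "((\<lambda>n. ?av n (translate act m s g) - \<psi> n s * ?av n g) \<longlongrightarrow> 0) F"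
      by (rule Lim_null_comparison[OF always_eventually error], rule allI)
         (rule twisted_average_translate[OF EL[OF g] \<psi> c])
    moreover have "((\<lambda>n. ?av n (translate act m s g) - \<psi> n s * ?av n g)
        \<longlongrightarrow> \<phi> (translate act m s g) - \<xi> s * \<phi> g) F"
      by (intro tendsto_diff tendsto_mult lim lim_\<psi> inv g s)
    ultimately have "\<phi> (translate act m s g) - \<xi> s * \<phi> g = 0"
      using tendsto_unique[OF F(1)] by blast
    then show ?thesis by simp
  qed
  obtain h g where h: "square_integrable m h" and rep: "\<And>f. f \<in> E \<Longrightarrow> \<phi> f = inner_L2 m f h"
    and g: "\<And>k :: nat. g k \<in> E" "(\<lambda>k. norm_sq m (\<lambda>x. g k x - h x)) \<longlonglongrightarrow> 0"
    by (rule linear_functional_representation[OF E(1) sq add scale bound]) blast+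
  have "AE y in m. h (act s y) = \<xi> s * h y" if "s \<in> H" for s
  proof (rule representative_equivariant[where E = E and \<phi> = \<phi> and g = g])
    show "translate act m s g \<in> E" "\<phi> (translate act m s g) = \<xi> s * \<phi> g" if "g \<in> E" for g
      using that \<open>s \<in> H\<close> inv equiv by blast+
  qed (fact sys sq h rep g dual_group_norm[OF \<xi>])+
  then have eigen: "AE y in m. h (act t y) = \<xi> t * h y" for t
    by (rule eigenfunction_equation_extends[OF \<mu> sys H \<xi> h])
  show ?thesis
  proof (cases "AE y in m. h y = 0")
    case True
    have "inner_L2 m f h = (LINT y|m. 0)"
      unfolding inner_L2_def
    proof (rule integral_cong_AE)
      show "AE y in m. f y * cnj (h y) = 0"
        using True by eventually_elim simp
    qed (use square_integrable_mult_cnj[OF sq[OF f] h] in auto)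
    then show ?thesis
      using rep[OF f] by simp
  next
    case False
    then have "eigenfunction act m \<xi> h"
      using h eigen by (simp add: eigenfunction_def)
    then show ?thesis
      using rep[OF f] perp by simp
  qed
qed

end

section \<open>Uniform convergence over a compact set of characters\<close>
lemma twisted_averages_uniformly_null:
  fixes \<mu> :: "'g::{topological_ab_group_add, t2_space} measure"
  assumes \<mu>: "haar_measure \<mu>" and sys: "measurable_dynamical_system act m"
    and folner: "Folner_sequence \<mu> A" and H: "dense_subgroup H"
    and K: "compactin dual_topology K"
    and E: "complex_fun.subspace E" "E \<subseteq> L2_Linf m" "invariant_under act m H E"
    and perp: "perpendicular act m E K" and f: "f \<in> E" and gen: "generic \<mu> act m A E H x"
  shows "(\<lambda>n. SUP \<xi>\<in>K. ennreal (cmod (twisted_average \<mu> act x (A n) \<xi> f))) \<longlonglongrightarrow> 0"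
proof (rule ccontr)
  interpret orbit_averages \<mu> act m A x
    using \<mu> sys folner gen by unfold_locales (simp_all add: generic_def)
  let ?av = "\<lambda>n \<xi> g. twisted_average \<mu> act x (A n) \<xi> g"
  let ?S = "\<lambda>n. SUP \<xi>\<in>K. ennreal (cmod (?av n \<xi> f))"
  assume "\<not> ?S \<longlonglongrightarrow> 0"
  have "\<exists>r>0. \<not> eventually (\<lambda>n. ?S n < ennreal r) sequentially"
  proof (rule ccontr)
    assume none: "\<not> ?thesis"
    have "?S \<longlonglongrightarrow> 0"
      by (rule tendsto_zero_ennreal) (use none in blast)
    then show False
      using \<open>\<not> ?S \<longlonglongrightarrow> 0\<close> by contradiction
  qed
  then obtain r where r: "0 < r" "\<not> eventually (\<lambda>n. ?S n < ennreal r) sequentially"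
    by blast
  define B where "B = {n. \<exists>\<xi>\<in>K. r / 2 \<le> cmod (?av n \<xi> f)}"
  have small: "?S n < ennreal r" if "n \<notin> B" for n
  proof -
    have "?S n \<le> ennreal (r / 2)"
    proof (rule SUP_least)
      fix \<xi> assume "\<xi> \<in> K"
      then have "cmod (?av n \<xi> f) < r / 2"
        using that by (auto simp: B_def not_le)
      then show "ennreal (cmod (?av n \<xi> f)) \<le> ennreal (r / 2)"
        by (intro ennreal_leI) simp
    qed
    also have "\<dots> < ennreal r"
      using r(1) by (simp add: ennreal_less_iff)
    finally show ?thesis .
  qed
  have freq: "\<not> eventually (\<lambda>n. n \<notin> B) sequentially"
  proof
    assume "eventually (\<lambda>n. n \<notin> B) sequentially"
    then have "eventually (\<lambda>n. ?S n < ennreal r) sequentially"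
      by (rule eventually_mono) (rule small)
    with r(2) show False ..
  qed
  define F0 where "F0 = inf sequentially (principal B)"
  have F0: "F0 \<noteq> bot"
    using freq by (simp add: F0_def trivial_limit_def eventually_inf_principal)
  have "B \<noteq> {}"
    using freq by auto
  then obtain \<xi>0 where "\<xi>0 \<in> K"
    by (auto simp: B_def)
  then have "\<forall>n. \<exists>\<xi>. \<xi> \<in> K \<and> (n \<in> B \<longrightarrow> r / 2 \<le> cmod (?av n \<xi> f))"
    unfolding B_def by blast
  from choice[OF this]
  obtain \<psi> where \<psi>: "\<And>n. \<psi> n \<in> K" "\<And>n. n \<in> B \<Longrightarrow> r / 2 \<le> cmod (?av n (\<psi> n) f)"
    by blast
  have K_dual: "K \<subseteq> dual_group" and K_compact: "compact K"
    using compactin_dual_topology_imp_compact[OF K] by blast+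
  have "\<forall>g\<in>E. \<exists>c. \<forall>y. cmod (g y) \<le> c"
    using E(2) L2_Linf_bounded by blast
  from bchoice[OF this] obtain b where b: "\<And>g y. g \<in> E \<Longrightarrow> cmod (g y) \<le> b g"
    by blast
  \<comment> \<open>The value \<open>0\<close> off \<open>E\<close> gives bounds for all arguments, as the product space has a factor for
    each function.\<close>
  define \<Phi> where "\<Phi> n g = (if g \<in> E then ?av n (\<psi> n) g else 0)" for n g
  define c where "c g = (if g \<in> E then b g else 0)" for g
  have \<Phi>_bound: "cmod (\<Phi> n g) \<le> c g" for n g
  proof (cases "g \<in> E")
    case True
    have "cmod (?av n (\<psi> n) g) \<le> b g"
      using True E(2) K_dual \<psi>(1)[of n] by (intro twisted_average_bound b) blast+
    then show ?thesis
      using True by (simp only: \<Phi>_def c_def if_True)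
  qed (simp add: \<Phi>_def c_def)
  have compact: "compact (K \<times> {\<phi>. \<forall>g. cmod (\<phi> g) \<le> c g})"
    by (rule compact_Times[OF K_compact compact_bounded_functions])
  have mem: "(\<psi> n, \<Phi> n) \<in> K \<times> {\<phi>. \<forall>g. cmod (\<phi> g) \<le> c g}" for n
    by (intro SigmaI CollectI allI \<psi>(1) \<Phi>_bound)
  obtain p F where p: "p \<in> K \<times> {\<phi>. \<forall>g. cmod (\<phi> g) \<le> c g}" "F \<noteq> bot" "F \<le> F0"
      "((\<lambda>n. (\<psi> n, \<Phi> n)) \<longlongrightarrow> p) F"
    by (rule compact_cluster_filter[OF compact mem F0])
  obtain \<xi> \<phi> where p_eq: "p = (\<xi>, \<phi>)" and \<xi>: "\<xi> \<in> K"
    using p(1) by auto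
  have lim_\<psi>: "((\<lambda>n. \<psi> n t) \<longlongrightarrow> \<xi> t) F" for t
    by (rule fun_tendsto_pointwise[where f = \<psi> and l = \<xi>]) (use tendsto_fst[OF p(4)] in \<open>simp add: p_eq\<close>)
  have "((\<lambda>n. \<Phi> n g) \<longlongrightarrow> \<phi> g) F" for g
    by (rule fun_tendsto_pointwise[where f = \<Phi> and l = \<phi>]) (use tendsto_snd[OF p(4)] in \<open>simp add: p_eq\<close>)
  note lim_\<Phi> = this
  have lim: "((\<lambda>n. ?av n (\<psi> n) g) \<longlongrightarrow> \<phi> g) F" if "g \<in> E" for g
    using lim_\<Phi>[of g] by (simp only: \<Phi>_def that if_True)
  have "\<phi> f = 0"
  proof (rule limit_functional_vanishes[OF E H gen _ _ _ p(2) _ lim_\<psi> lim f])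
    show "inner_L2 m f h = 0" if "eigenfunction act m \<xi> h" for h
    proof -
      have "eigenvalue act m \<xi>"
        using \<xi> K_dual that unfolding eigenvalue_def by blast
      then show ?thesis
        using perp f \<xi> that unfolding perpendicular_def by blast
    qed
    show "F \<le> sequentially"
      using p(3) by (simp add: F0_def)
    show "\<psi> n \<in> dual_group" "\<xi> \<in> dual_group" for n
      using K_dual \<psi>(1) \<xi> by blast+
  qed
  then have "((\<lambda>n. cmod (?av n (\<psi> n) f)) \<longlongrightarrow> 0) F"
    using tendsto_norm[OF lim[OF f]] by simp
  then have "eventually (\<lambda>n. cmod (?av n (\<psi> n) f) < r / 2) F"
    using r(1) by (intro order_tendstoD(2)) auto
  moreover have "eventually (\<lambda>n. n \<in> B) F"
    using p(3) by (simp add: F0_def le_principal)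
  ultimately have "eventually (\<lambda>_. False) F"
  proof eventually_elim
    case (elim n)
    then show ?case
      using \<psi>(2)[of n] by linarith
  qed
  then show False
    using p(2) by (simp add: eventually_False)
qed

theorem proposition3p7:
  fixes haar :: "'g::{topological_ab_group_add, t2_space} measure"
    and act :: "'g \<Rightarrow> 'x \<Rightarrow> 'x"
    and m :: "'x measure"
    and A :: "nat \<Rightarrow> 'g set"
    and G' :: "'g set"
    and K :: "('g \<Rightarrow> complex) set"
    and E :: "('x \<Rightarrow> complex) set"
    and f :: "'x \<Rightarrow> complex"
    and x :: 'x
  assumes "locally_compact_space (euclidean :: 'g topology)"
    and "sigma_compact_group TYPE('g)"
    and "haar_measure haar"
    and "measurable_dynamical_system act m"
    and "Folner_sequence haar A"
    and "dense_subgroup G'"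
    and "compactin dual_topology K"
    and "complex_fun.subspace E"
    and "E \<subseteq> L2_Linf m"
    and "invariant_under act m G' E"
    and "\<exists>F. countable F \<and> core m F E"
    and "perpendicular act m E K"
    and "f \<in> E"
    and "generic haar act m A E G' x"
  shows "(\<lambda>n. SUP \<xi>\<in>K. ennreal (1 / measure haar (A n) *
                cmod (LINT t:A n|haar. f (act t x) * cnj (\<xi> t)))) \<longlonglongrightarrow> 0"
  using twisted_averages_uniformly_null[OF assms(3-10,12-14)]
  by (simp add: twisted_average_def norm_divide)

end
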